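(* Let $\nu$ be a translation invariant $\sigma$-finite measure on $\mathcal{P}(\mathbb{Z})\setminus\{\emptyset\}$. Assume that $P(X^\nu\equiv1)<1$, or equivalently, that $\nu(\mathcal{S}_0)<\infty$. Then the following are equivalent. (i) $\nu$ cannot be expressed as $\nu_1+\nu_2$ where $\nu_1$ and $\nu_2$ are translation invariant measures and $\nu_2$ is a nonzero finite measure. (ii) $\nu(\mathcal{Z}^c)=0$. (iii) $X^\nu$ is ergodic.
   Context: Identify the power set $\mathcal{P}(\mathbb{Z})$ with $\{0,1\}^{\mathbb{Z}}$ (product topology, Borel $\sigma$-algebra). For a $\sigma$-finite measure $\nu$ on $\mathcal{P}(\mathbb{Z})\setminus\{\emptyset\}$, let $Y^\nu=\{B_j\}_{j\in I}$ be the Poisson process on $\mathcal{P}(\mathbb{Z})\setminus\{\emptyset\}$ with intensity measure $\nu$. Define $X^\nu=(X^\nu_i)_{i\in\mathbb{Z}}$ by $X^\nu_i=1$ if $i\in\bigcup_{j\in I}B_j$ and $X^\nu_i=0$ otherwise. Translation invariance of $\nu$ is with respect to the natural action of $\mathbb{Z}$ on subsets of $\mathbb{Z}$; ergodicity of $X^\nu$ is with respect to the shift. Notation: $\mathcal{S}_0=\{T\in\mathcal{P}(\mathbb{Z}):0\in T\}$ and $$\mathcal{Z}=\Bigl\{\eta\in\{0,1\}^{\mathbb{Z}}:\lim_{n\to\infty}\frac1n\sum_{k=0}^{n-1}\eta_k=0\Bigr\}.$$ *)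

theory Defs
  imports "HOL-Probability.Probability"
begin

text \<open>The power set of the integers is identified with the space of binary sequences \<open>int \<Rightarrow> bool\<close>
  through \<open>T \<mapsto> (\<lambda>i. i \<in> T)\<close>. The type \<open>bool\<close> is discrete, so \<open>borel\<close> below is the Borel
  sigma-algebra of the product topology.\<close>

instance bool :: second_countable_topology
proof
  have "open = generate_topology (UNIV :: bool set set)"
    by (auto intro: generate_topology.Basis simp: fun_eq_iff Topological_Spaces.open_discrete)
  moreover have "countable (UNIV :: bool set set)"
    by simp
  ultimately show "\<exists>B :: bool set set. countable B \<and> open = generate_topology B"
    by blast
qed

definition subsets_borel :: "int set measure" where
  "subsets_borel = vimage_algebra UNIV (\<lambda>T i. i \<in> T) (borel :: (int \<Rightarrow> bool) measure)"

definition nonempty_subsets_borel :: "int set measure" where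
  "nonempty_subsets_borel = restrict_space subsets_borel (- {{}})"

definition translate :: "int \<Rightarrow> int set \<Rightarrow> int set" where
  "translate n T = (\<lambda>i. i + n) ` T"

definition translation_invariant :: "int set measure \<Rightarrow> bool" where
  "translation_invariant \<nu> \<longleftrightarrow> (\<forall>n. distr \<nu> \<nu> (translate n) = \<nu>)"

text \<open>A random, at most countable configuration of points, possibly with repetitions, is a partial
  enumeration \<open>Y \<omega> :: nat \<rightharpoonup> 'a\<close>; its index set is \<open>dom (Y \<omega>)\<close>.
  \<open>num_points Y A \<omega>\<close> counts the points in \<open>A\<close> with multiplicity.\<close>

definition num_points :: "('w \<Rightarrow> nat \<rightharpoonup> 'a) \<Rightarrow> 'a set \<Rightarrow> 'w \<Rightarrow> ennreal" where
  "num_points Y A \<omega> = emeasure (count_space UNIV) {j. \<exists>x\<in>A. Y \<omega> j = Some x}"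

locale poisson_process = prob_space M
  for M :: "'w measure" and \<nu> :: "'a measure" and Y :: "'w \<Rightarrow> nat \<rightharpoonup> 'a" +
  assumes points_in_space: "\<omega> \<in> space M \<Longrightarrow> ran (Y \<omega>) \<subseteq> space \<nu>"
    and measurable_num_points: "A \<in> sets \<nu> \<Longrightarrow> num_points Y A \<in> borel_measurable M"
    and poisson_finite: "\<lbrakk>A \<in> sets \<nu>; emeasure \<nu> A < \<infinity>\<rbrakk> \<Longrightarrow>
      prob {\<omega> \<in> space M. num_points Y A \<omega> = of_nat k} =
        measure \<nu> A ^ k / fact k * exp (- measure \<nu> A)"
    and poisson_infinite: "\<lbrakk>A \<in> sets \<nu>; emeasure \<nu> A = \<infinity>\<rbrakk> \<Longrightarrow>
      AE \<omega> in M. num_points Y A \<omega> = \<infinity>"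
    and independent: "\<lbrakk>finite \<A>; \<A> \<subseteq> sets \<nu>; disjoint \<A>\<rbrakk> \<Longrightarrow>
      indep_vars (\<lambda>_. borel) (num_points Y) \<A>"

text \<open>The process \<open>X\<close>, with \<open>True\<close> standing for \<open>1\<close>.\<close>

definition union_process :: "('w \<Rightarrow> nat \<rightharpoonup> int set) \<Rightarrow> 'w \<Rightarrow> int \<Rightarrow> bool" where
  "union_process Y \<omega> i \<longleftrightarrow> i \<in> \<Union> (ran (Y \<omega>))"

definition shift :: "(int \<Rightarrow> bool) \<Rightarrow> int \<Rightarrow> bool" where
  "shift \<eta> i = \<eta> (i + 1)"

definition shift_ergodic :: "(int \<Rightarrow> bool) measure \<Rightarrow> bool" where
  "shift_ergodic \<mu> \<longleftrightarrow> distr \<mu> \<mu> shift = \<mu> \<and>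
     (\<forall>A\<in>sets \<mu>. shift -` A \<inter> space \<mu> = A \<longrightarrow> measure \<mu> A = 0 \<or> measure \<mu> A = 1)"

definition ergodic_process :: "'w measure \<Rightarrow> ('w \<Rightarrow> int \<Rightarrow> bool) \<Rightarrow> bool" where
  "ergodic_process M X \<longleftrightarrow> shift_ergodic (distr M borel X)"

definition containing_zero :: "int set set" where
  "containing_zero = {T. 0 \<in> T}"

definition zero_density :: "int set set" where
  "zero_density =
     {T. (\<lambda>n. (1 / real n) * (\<Sum>k<n. of_bool (int k \<in> T))) \<longlonglongrightarrow> 0}"

definition has_finite_invariant_part :: "int set measure \<Rightarrow> bool" where
  "has_finite_invariant_part \<nu> \<longleftrightarrow> (\<exists>\<nu>\<^sub>1 \<nu>\<^sub>2.
     sets \<nu>\<^sub>1 = sets \<nu> \<and> sets \<nu>\<^sub>2 = sets \<nu> \<and>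
     (\<forall>A\<in>sets \<nu>. emeasure \<nu> A = emeasure \<nu>\<^sub>1 A + emeasure \<nu>\<^sub>2 A) \<and>
     translation_invariant \<nu>\<^sub>1 \<and> translation_invariant \<nu>\<^sub>2 \<and>
     finite_measure \<nu>\<^sub>2 \<and> emeasure \<nu>\<^sub>2 (space \<nu>\<^sub>2) \<noteq> 0)"

end

theory Submission
  imports Defs
begin

text \<open>Everything is governed by the void probabilities
  \<open>P(X \<inter> F = {}) = exp (- \<nu> {T. T \<inter> F \<noteq> {}})\<close>, \<open>F\<close> finite, which determine the law of \<open>X\<close>.

  If \<open>\<nu>\<close> charges sets of positive upper density, then \<open>{T. upper density > \<alpha>}\<close> is an invariant set of
  positive measure for some \<open>\<alpha> > 0\<close>, and a maximal inequality bounds its measure by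
  \<open>2 \<nu>(S\<^sub>0) / \<alpha>\<close>; restricting \<open>\<nu>\<close> to it splits off a finite invariant part.
  Conditioning on \<open>Y\<close> having no point in such a finite invariant set \<open>A\<close> gives
  an invariant law, absolutely continuous with respect to that of \<open>X\<close> but different from it, so \<open>X\<close> is
  not ergodic. Conversely, if \<open>\<nu>\<close>-almost every set has density zero, dominated convergence shows that a
  finite invariant part does not charge \<open>S\<^sub>0\<close>, hence vanishes, and that the averages over \<open>k < n\<close> of
  \<open>\<nu> {T. T meets F and G + k}\<close> tend to zero; by the void probabilities this is mixing in the
  Cesaro sense for void events, which extends to all events and yields ergodicity.\<close>

section \<open>Cesaro mixing and ergodicity\<close>

text \<open>Dynkin's pi-lambda argument for a limit of set functions: the domination of
  \<open>q n\<close> by \<open>prob\<close>, uniform in \<open>n\<close>, lets the limit pass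
  through countable disjoint unions. The free factor \<open>c\<close> allows the result to be used
  for either argument of a bilinear expression.\<close>

lemma (in prob_space) tendsto_measure_Int_stable:
  fixes q :: "nat \<Rightarrow> 'a set \<Rightarrow> real" and c :: real
  assumes G: "Int_stable G" "G \<subseteq> Pow (space M)" "sets M = sigma_sets (space M) G"
    and bound: "\<And>n A. A \<in> events \<Longrightarrow> 0 \<le> q n A \<and> q n A \<le> prob A"
    and compl: "\<And>n A. A \<in> events \<Longrightarrow> q n (space M - A) = q n (space M) - q n A"
    and additive: "\<And>n A. range A \<subseteq> events \<Longrightarrow> disjoint_family A \<Longrightarrow>
      (\<lambda>i. q n (A i)) sums q n (\<Union>i::nat. A i)"
    and total: "(\<lambda>n. q n (space M)) \<longlonglongrightarrow> c"
    and generator: "\<And>A. A \<in> G \<Longrightarrow> (\<lambda>n. q n A) \<longlonglongrightarrow> c * prob A"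
    and A: "A \<in> events"
  shows "(\<lambda>n. q n A) \<longlonglongrightarrow> c * prob A"
  using G(1,2) A[unfolded G(3)]
proof (induction rule: sigma_sets_induct_disjoint)
  case (basic A)
  then show ?case by (rule generator)
next
  case empty
  have "q n {} = 0" for n
    using bound[of "{}" n] by simp
  then show ?case by simp
next
  case (compl A)
  then have "A \<in> events" by (simp add: G(3))
  moreover have "(\<lambda>n. q n (space M) - q n A) \<longlonglongrightarrow> c - c * prob A"
    by (intro tendsto_diff total compl)
  ultimately show ?case
    by (simp add: assms(5) prob_compl right_diff_distrib)
next
  case (union A)
  then have ev: "range A \<subseteq> events" by (simp add: G(3))
  have sums: "(\<lambda>i. prob (A i)) sums prob (\<Union>i. A i)"
    by (rule finite_measure_UNION[OF ev union(1)])
  have "norm (q n (A k)) \<le> prob (A k)" for n k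
    using bound[of "A k" n] ev by auto
  \<comment> \<open>Tannery's theorem exchanges limit and series; the summable majorant is
    \<open>prob (A k)\<close>.\<close>
  then have "(\<lambda>n. \<Sum>i. q n (A i)) \<longlonglongrightarrow> (\<Sum>i. c * prob (A i))"
    using tannerys_theorem[of "\<lambda>k n. q n (A k)" "\<lambda>k. c * prob (A k)" sequentially "\<lambda>k. prob (A k)",
        OF union(3) always_eventually sums_summable[OF sums]] by auto
  moreover have "(\<Sum>i. q n (A i)) = q n (\<Union>i. A i)" for n
    using additive[OF ev union(1)] by (simp add: sums_iff)
  moreover have "(\<Sum>i. c * prob (A i)) = c * prob (\<Union>i. A i)"
    using sums_mult[OF sums, of c] by (simp add: sums_iff)
  ultimately show ?case by simp
qed

lemma measurable_funpow:
  "T \<in> measurable M M \<Longrightarrow> (T ^^ k) \<in> measurable M M"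
  by (induction k) (auto intro: measurable_compose simp: comp_def)

lemma emeasure_funpow_vimage:
  assumes T: "T \<in> measurable M M" "distr M M T = M" and A: "A \<in> sets M"
  shows "emeasure M ((T ^^ k) -` A \<inter> space M) = emeasure M A"
proof (induction k)
  case 0
  show ?case using sets.sets_into_space[OF A] by (simp add: Int_absorb2)
next
  case (Suc k)
  have "(T ^^ Suc k) -` A \<inter> space M = T -` ((T ^^ k) -` A \<inter> space M) \<inter> space M"
    using measurable_space[OF T(1)] by (auto simp: funpow_swap1)
  then have "emeasure M ((T ^^ Suc k) -` A \<inter> space M)
      = emeasure (distr M M T) ((T ^^ k) -` A \<inter> space M)"
    using T(1) measurable_sets[OF measurable_funpow[OF T(1)] A] by (simp add: emeasure_distr)
  then show ?case unfolding T(2) Suc .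
qed

lemma cesaro_const: "(\<lambda>n. (\<Sum>k<n. b) / real n) \<longlonglongrightarrow> b" for b :: real
  \<comment> \<open>At \<open>n = 0\<close> the quotient is 0 by the convention for division by
    zero; from \<open>n = 1\<close> on it is constantly \<open>b\<close>.\<close>
  by (rule LIMSEQ_offset[of _ 1]) (simp del: of_nat_Suc)

text \<open>For fixed B the averages are additive in A, and for fixed A they are additive in B, so
  the pi-lambda argument is run twice, once per argument.\<close>

lemma (in prob_space) cesaro_mixing_Int_stable:
  assumes T: "T \<in> measurable M M" "distr M M T = M"
    and G: "Int_stable G" "G \<subseteq> Pow (space M)" "sets M = sigma_sets (space M) G"
    and generator: "\<And>A B. A \<in> G \<Longrightarrow> B \<in> G \<Longrightarrow>
      (\<lambda>n. (\<Sum>k<n. prob (A \<inter> (T ^^ k) -` B)) / real n) \<longlonglongrightarrow> prob A * prob B"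
    and A: "A \<in> events" and B: "B \<in> events"
  shows "(\<lambda>n. (\<Sum>k<n. prob (A \<inter> (T ^^ k) -` B)) / real n) \<longlonglongrightarrow> prob A * prob B"
proof -
  have G_events: "A \<in> G \<Longrightarrow> A \<in> events" for A
    using G(3) by auto
  have T_sets: "A \<inter> (T ^^ k) -` B \<in> events" if "A \<in> events" "B \<in> events" for A B k
  proof -
    have "A \<inter> (T ^^ k) -` B = A \<inter> ((T ^^ k) -` B \<inter> space M)"
      using sets.sets_into_space[OF that(1)] by auto
    then show ?thesis
      using that measurable_sets[OF measurable_funpow[OF T(1)]] by simp
  qed
  have prob_T: "prob ((T ^^ k) -` B \<inter> space M) = prob B" if "B \<in> events" for B k
    using emeasure_funpow_vimage[OF T that] by (simp add: measure_def)
  have T_space: "A \<inter> (T ^^ k) -` space M = A" if "A \<in> events" for A k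
    using sets.sets_into_space[OF that] measurable_space[OF measurable_funpow[OF T(1), of k]] by auto
  have le_A: "prob (A \<inter> (T ^^ k) -` B) \<le> prob A" if "A \<in> events" for A B k
    using that by (intro finite_measure_mono) auto
  \<comment> \<open>Invariance supplies the majorant that the second run needs.\<close>
  have le_B: "prob (A \<inter> (T ^^ k) -` B) \<le> prob B" if "A \<in> events" "B \<in> events" for A B k
  proof -
    have "prob (A \<inter> (T ^^ k) -` B) \<le> prob ((T ^^ k) -` B \<inter> space M)"
      using that sets.sets_into_space[OF that(1)] measurable_sets[OF measurable_funpow[OF T(1)]]
      by (intro finite_measure_mono) auto
    then show ?thesis using prob_T[OF that(2)] by simp
  qed
  have avg_le: "(\<Sum>k<n. x k) / real n \<le> b" if "\<And>k. x k \<le> b" "0 \<le> b" for x :: "nat \<Rightarrow> real" and b n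
    using sum_bounded_above[of "{..<n}" x b] that by (cases "n = 0") (auto simp: field_simps)
  \<comment> \<open>First run: A becomes arbitrary while B stays in the generator. The factor
    \<open>prob B\<close> takes the place of \<open>c\<close>, hence the order of the
    product.\<close>
  have left: "(\<lambda>n. (\<Sum>k<n. prob (A \<inter> (T ^^ k) -` B)) / real n) \<longlonglongrightarrow> prob B * prob A"
    if A: "A \<in> events" and B: "B \<in> G" for A B
  proof (rule tendsto_measure_Int_stable[OF G _ _ _ _ _ A])
    have B': "B \<in> events" using G_events B .
    fix n
    show "0 \<le> (\<Sum>k<n. prob (A \<inter> (T ^^ k) -` B)) / real n \<and>
        (\<Sum>k<n. prob (A \<inter> (T ^^ k) -` B)) / real n \<le> prob A" if "A \<in> events" for A
      using that le_A by (auto intro!: avg_le sum_nonneg divide_nonneg_nonneg)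
    show "(\<Sum>k<n. prob ((space M - A) \<inter> (T ^^ k) -` B)) / real n =
      (\<Sum>k<n. prob (space M \<inter> (T ^^ k) -` B)) / real n - (\<Sum>k<n. prob (A \<inter> (T ^^ k) -` B)) / real n"
      if A: "A \<in> events" for A
    proof -
      have "prob ((space M - A) \<inter> (T ^^ k) -` B) =
          prob (space M \<inter> (T ^^ k) -` B) - prob (A \<inter> (T ^^ k) -` B)" for k
        using sets.sets_into_space[OF A] T_sets[OF _ B'] A
        by (subst finite_measure_Diff[symmetric]) (auto intro!: arg_cong[of _ _ prob])
      then show ?thesis by (simp add: sum_subtractf diff_divide_distrib)
    qed
    show "(\<lambda>i. (\<Sum>k<n. prob (A i \<inter> (T ^^ k) -` B)) / real n) sums
        ((\<Sum>k<n. prob ((\<Union>i. A i) \<inter> (T ^^ k) -` B)) / real n)"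
      if A: "range A \<subseteq> events" "disjoint_family A" for A :: "nat \<Rightarrow> 'a set"
    proof (intro sums_divide sums_sum)
      fix k
      have "(\<lambda>i. prob (A i \<inter> (T ^^ k) -` B)) sums prob (\<Union>i. A i \<inter> (T ^^ k) -` B)"
        using A T_sets[OF _ B'] by (intro finite_measure_UNION) (auto simp: disjoint_family_on_def)
      then show "(\<lambda>i. prob (A i \<inter> (T ^^ k) -` B)) sums prob ((\<Union>i. A i) \<inter> (T ^^ k) -` B)"
        by simp
    qed
    show "(\<lambda>n. (\<Sum>k<n. prob (space M \<inter> (T ^^ k) -` B)) / real n) \<longlonglongrightarrow> prob B"
      using prob_T[OF B'] cesaro_const by (simp add: Int_commute)
    show "(\<lambda>n. (\<Sum>k<n. prob (A \<inter> (T ^^ k) -` B)) / real n) \<longlonglongrightarrow> prob B * prob A" if "A \<in> G" for A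
      using generator[OF that B] by (simp add: mult.commute)
  qed
  show ?thesis
  proof (rule tendsto_measure_Int_stable[OF G _ _ _ _ _ B])
    fix n
    show "0 \<le> (\<Sum>k<n. prob (A \<inter> (T ^^ k) -` B)) / real n \<and>
        (\<Sum>k<n. prob (A \<inter> (T ^^ k) -` B)) / real n \<le> prob B" if "B \<in> events" for B
      using that le_B[OF A] by (auto intro!: avg_le sum_nonneg divide_nonneg_nonneg)
    show "(\<Sum>k<n. prob (A \<inter> (T ^^ k) -` (space M - B))) / real n =
      (\<Sum>k<n. prob (A \<inter> (T ^^ k) -` space M)) / real n - (\<Sum>k<n. prob (A \<inter> (T ^^ k) -` B)) / real n"
      if B: "B \<in> events" for B
    proof -
      have "prob (A \<inter> (T ^^ k) -` (space M - B)) =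
          prob (A \<inter> (T ^^ k) -` space M) - prob (A \<inter> (T ^^ k) -` B)" for k
        using sets.sets_into_space[OF A] T_sets[OF A] B
          measurable_space[OF measurable_funpow[OF T(1), of k]] sets.sets_into_space[OF B]
        by (subst finite_measure_Diff[symmetric]) (auto intro!: arg_cong[of _ _ prob])
      then show ?thesis by (simp add: sum_subtractf diff_divide_distrib)
    qed
    show "(\<lambda>i. (\<Sum>k<n. prob (A \<inter> (T ^^ k) -` B i)) / real n) sums
        ((\<Sum>k<n. prob (A \<inter> (T ^^ k) -` (\<Union>i. B i))) / real n)"
      if B: "range B \<subseteq> events" "disjoint_family B" for B :: "nat \<Rightarrow> 'a set"
    proof (intro sums_divide sums_sum)
      fix k
      have "(\<lambda>i. prob (A \<inter> (T ^^ k) -` B i)) sums prob (\<Union>i. A \<inter> (T ^^ k) -` B i)"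
        using B T_sets[OF A] by (intro finite_measure_UNION) (auto simp: disjoint_family_on_def)
      then show "(\<lambda>i. prob (A \<inter> (T ^^ k) -` B i)) sums prob (A \<inter> (T ^^ k) -` (\<Union>i. B i))"
        by (simp add: vimage_UN)
    qed
    show "(\<lambda>n. (\<Sum>k<n. prob (A \<inter> (T ^^ k) -` space M)) / real n) \<longlonglongrightarrow> prob A"
      using cesaro_const by (simp add: T_space[OF A])
    show "(\<lambda>n. (\<Sum>k<n. prob (A \<inter> (T ^^ k) -` B)) / real n) \<longlonglongrightarrow> prob A * prob B" if "B \<in> G" for B
      using left[OF A that] by (simp add: mult.commute)
  qed
qed

text \<open>An invariant event is mixed with itself: its averages are constantly
  \<open>prob A\<close> and converge to the square of \<open>prob A\<close>.\<close>

lemma (in prob_space) invariant_event_0_1: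
  assumes T: "T \<in> measurable M M" "distr M M T = M"
    and G: "Int_stable G" "G \<subseteq> Pow (space M)" "sets M = sigma_sets (space M) G"
    and generator: "\<And>A B. A \<in> G \<Longrightarrow> B \<in> G \<Longrightarrow>
      (\<lambda>n. (\<Sum>k<n. prob (A \<inter> (T ^^ k) -` B)) / real n) \<longlonglongrightarrow> prob A * prob B"
    and A: "A \<in> events" and inv: "T -` A \<inter> space M = A"
  shows "prob A = 0 \<or> prob A = 1"
proof -
  have "x \<in> A \<longleftrightarrow> (T ^^ k) x \<in> A" if "x \<in> space M" for x k
    using that
  proof (induction k arbitrary: x)
    case (Suc k)
    then show ?case using inv measurable_space[OF T(1)] by (auto simp: funpow_swap1)
  qed simp
  then have "A \<inter> (T ^^ k) -` A = A" for k
    using sets.sets_into_space[OF A] by auto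
  then have "(\<lambda>n. (\<Sum>k<n. prob A) / real n) \<longlonglongrightarrow> prob A * prob A"
    using cesaro_mixing_Int_stable[OF T G generator A A] by simp
  moreover have "(\<lambda>n. (\<Sum>k<n. prob A) / real n) \<longlonglongrightarrow> prob A"
    by (rule cesaro_const)
  ultimately have "prob A * prob A = prob A"
    by (rule LIMSEQ_unique)
  then show ?thesis by simp
qed

section \<open>Rigidity of ergodic measures under absolute continuity\<close>

text \<open>The Radon-Nikodym density of N is invariant along orbits up to null sets, and ergodicity
  forces it to lie almost everywhere on one side of 1; equal total masses then leave only N =
  M.\<close>

lemma (in prob_space) ergodic_absolutely_continuous_unique:
  assumes T: "T \<in> measurable M M" "distr M M T = M" and R: "R \<in> measurable M M"
    and RT: "\<And>x. x \<in> space M \<Longrightarrow> R (T x) = x"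
    and ergodic: "\<And>A. A \<in> events \<Longrightarrow> T -` A \<inter> space M = A \<Longrightarrow> prob A = 0 \<or> prob A = 1"
    and N: "prob_space N" "sets N = sets M" "distr N N T = N" "absolutely_continuous M N"
  shows "N = M"
proof -
  interpret N: prob_space N by fact
  have space_N: "space N = space M" using N(2) by (rule sets_eq_imp_space_eq)
  obtain f where f[measurable]: "f \<in> borel_measurable M" and dens: "density M f = N"
    using Radon_Nikodym[OF N(4,2)] by auto
  have TN: "T \<in> measurable N N" using T(1) N(2) by (simp cong: measurable_cong_sets)
  note [measurable] = T(1) R
  \<comment> \<open>As M and N are both invariant, f composed with T is a second density of N. The
    left inverse R presents each B as the preimage under T of some C, so that both invariances
    apply.\<close>
  have "density M (\<lambda>x. f (T x)) = N"
  proof (rule measure_eqI)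
    fix B assume "B \<in> sets (density M (\<lambda>x. f (T x)))"
    then have B[measurable]: "B \<in> sets M" by simp
    define C where "C = R -` B \<inter> space M"
    have C[measurable]: "C \<in> sets M" unfolding C_def by measurable
    have BC: "indicator B x = (indicator C (T x) :: ennreal)" if "x \<in> space M" for x
      using that measurable_space[OF T(1)] RT by (auto simp: C_def split: split_indicator)
    have "emeasure (density M (\<lambda>x. f (T x))) B = (\<integral>\<^sup>+x. f (T x) * indicator C (T x) \<partial>M)"
      by (subst emeasure_density) (auto intro!: nn_integral_cong simp: BC)
    also have "\<dots> = (\<integral>\<^sup>+x. f x * indicator C x \<partial>distr M M T)"
      by (subst nn_integral_distr) auto
    also have "\<dots> = emeasure N C"
      by (simp add: T(2) dens[symmetric] emeasure_density)
    also have "\<dots> = emeasure (distr N N T) C"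
      by (simp add: N(3))
    also have "\<dots> = emeasure N (T -` C \<inter> space N)"
      using TN C N(2) by (subst emeasure_distr) auto
    also have "T -` C \<inter> space N = B"
      using sets.sets_into_space[OF B] measurable_space[OF T(1)] RT by (auto simp: C_def space_N)
    finally show "emeasure (density M (\<lambda>x. f (T x))) B = emeasure N B" .
  qed (simp add: N(2))
  then have "AE x in M. f (T x) = f x"
    by (intro density_unique) (auto simp: dens)
  have inv: "AE x in M. f ((T ^^ k) x) = f x" for k
  proof (induction k)
    case (Suc k)
    have "AE x in distr M M T. f ((T ^^ k) x) = f x"
      unfolding T(2) by (rule Suc)
    then have "AE x in M. f ((T ^^ k) (T x)) = f (T x)"
      by (rule AE_distrD[OF T(1)])
    with \<open>AE x in M. f (T x) = f x\<close> show ?case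
      by eventually_elim (simp add: funpow_swap1)
  qed simp
  \<comment> \<open>So far f is invariant only almost everywhere, whereas \<open>ergodic\<close>
    asks for exactly invariant events. The limsup along the orbit is exactly invariant and agrees
    with f almost everywhere.\<close>
  define g where "g = (\<lambda>x. limsup (\<lambda>k. f ((T ^^ k) x)))"
  have [measurable]: "(T ^^ k) \<in> measurable M M" for k
    by (rule measurable_funpow[OF T(1)])
  have g[measurable]: "g \<in> borel_measurable M" unfolding g_def by measurable
  have "AE x in M. \<forall>k. f ((T ^^ k) x) = f x"
    using inv by (simp add: AE_all_countable)
  then have fg: "AE x in M. f x = g x"
    by eventually_elim (simp add: g_def Limsup_const)
  have gT: "g (T x) = g x" for x
    using limsup_shift[of "\<lambda>k. f ((T ^^ k) x)"] by (simp add: g_def funpow_swap1)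
  \<comment> \<open>The single level 1 suffices: a one-sided comparison of two probability measures
    is an equality, because complements reverse it.\<close>
  define A where "A = {x \<in> space M. g x > 1}"
  have A: "A \<in> events" unfolding A_def by measurable
  have "T -` A \<inter> space M = A"
    using measurable_space[OF T(1)] by (auto simp: A_def gT)
  with ergodic A have "prob A = 0 \<or> prob A = 1" by simp
  then have "(AE x in M. f x \<le> 1) \<or> (AE x in M. 1 \<le> f x)"
  proof
    assume "prob A = 0"
    then have "AE x in M. x \<notin> A" using prob_eq_0[OF A] by simp
    with fg AE_space have "AE x in M. f x \<le> 1" by eventually_elim (auto simp: A_def)
    then show ?thesis ..
  next
    assume "prob A = 1"
    then have "AE x in M. x \<in> A" using prob_eq_1[OF A] by simp
    with fg have "AE x in M. 1 \<le> f x" by eventually_elim (auto simp: A_def)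
    then show ?thesis ..
  qed
  then have "(\<forall>B\<in>events. N.prob B \<le> prob B) \<or> (\<forall>B\<in>events. prob B \<le> N.prob B)"
  proof (elim disj_forward)
    assume f1: "AE x in M. f x \<le> 1"
    show "\<forall>B\<in>events. N.prob B \<le> prob B"
    proof
      fix B assume [measurable]: "B \<in> events"
      have "emeasure N B = (\<integral>\<^sup>+x. f x * indicator B x \<partial>M)"
        by (simp add: dens[symmetric] emeasure_density)
      also have "\<dots> \<le> (\<integral>\<^sup>+x. indicator B x \<partial>M)"
        using f1 by (intro nn_integral_mono_AE) (auto elim!: eventually_mono split: split_indicator)
      finally show "N.prob B \<le> prob B" by (simp add: N.emeasure_eq_measure emeasure_eq_measure)
    qed
  next
    assume f1: "AE x in M. 1 \<le> f x"
    show "\<forall>B\<in>events. prob B \<le> N.prob B"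
    proof
      fix B assume [measurable]: "B \<in> events"
      have "emeasure M B = (\<integral>\<^sup>+x. indicator B x \<partial>M)" by simp
      also have "\<dots> \<le> (\<integral>\<^sup>+x. f x * indicator B x \<partial>M)"
        using f1 by (intro nn_integral_mono_AE) (auto elim!: eventually_mono split: split_indicator)
      also have "\<dots> = emeasure N B"
        by (simp add: dens[symmetric] emeasure_density)
      finally show "prob B \<le> N.prob B" by (simp add: N.emeasure_eq_measure emeasure_eq_measure)
    qed
  qed
  moreover have "N.prob (space M - B) = 1 - N.prob B" "prob (space M - B) = 1 - prob B"
    if "B \<in> events" for B
    using that N.prob_compl[of B] prob_compl[of B] by (simp_all add: N(2) space_N)
  moreover have "space M - B \<in> events" if "B \<in> events" for B
    using that by (rule sets.compl_sets)
  ultimately have "N.prob B = prob B" if "B \<in> events" for B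
    using that by (smt (verit))
  then show ?thesis
    by (intro measure_eqI) (auto simp: N.emeasure_eq_measure emeasure_eq_measure N(2))
qed

section \<open>Shift-invariant laws and void events\<close>

text \<open>These cylinder events are chosen because they are closed under intersection and, for
  finite F, have explicit probabilities for a Poisson union.\<close>

definition avoiding :: "int set \<Rightarrow> (int \<Rightarrow> bool) set" where
  "avoiding F = {\<eta>. \<forall>i\<in>F. \<not> \<eta> i}"

lemma avoiding_Un: "avoiding (F \<union> G) = avoiding F \<inter> avoiding G"
  by (auto simp: avoiding_def)

lemma Int_stable_avoiding: "Int_stable (avoiding ` Collect finite)"
  unfolding Int_stable_def by (auto simp: avoiding_Un[symmetric])

text \<open>The index set is countable and \<open>bool\<close> is second countable, so Borel sets
  and product-measurable sets coincide; it remains to recover each coordinate from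
  \<open>avoiding {i}\<close>, and conversely to use that coordinates are continuous.\<close>

lemma sets_borel_avoiding:
  "sets (borel :: (int \<Rightarrow> bool) measure) = sigma_sets UNIV (avoiding ` Collect finite)"
proof
  define S where "S = sigma UNIV (avoiding ` Collect finite)"
  have sets_S: "sets S = sigma_sets UNIV (avoiding ` Collect finite)" and space_S: "space S = UNIV"
    by (simp_all add: S_def)
  have "(\<lambda>\<eta> i. \<eta> i) \<in> measurable S (PiM UNIV (\<lambda>_. borel))"
  proof (rule measurable_PiM_single')
    fix i :: int
    have "avoiding {i} \<in> sets S" by (auto simp: sets_S)
    moreover have "avoiding {i} = {\<eta> \<in> space S. \<not> \<eta> i}"
      by (auto simp: avoiding_def space_S)
    ultimately have "Measurable.pred S (\<lambda>\<eta>. \<not> \<eta> i)"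
      by (simp add: pred_def)
    then have "Measurable.pred S (\<lambda>\<eta>. \<not> \<not> \<eta> i)" by (rule pred_intros_logic)
    then have "(\<lambda>\<eta>. \<eta> i) \<in> measurable S (count_space UNIV)" by simp
    then show "(\<lambda>\<eta>. \<eta> i) \<in> borel_measurable S"
      by (rule measurable_compose) simp
  qed simp
  then have id: "(\<lambda>\<eta>. \<eta>) \<in> measurable S (borel :: (int \<Rightarrow> bool) measure)"
    using measurable_cong_sets[OF refl sets_PiM_equal_borel] by blast
  show "sets (borel :: (int \<Rightarrow> bool) measure) \<subseteq> sigma_sets UNIV (avoiding ` Collect finite)"
    using measurable_sets[OF id] by (auto simp: space_S sets_S)
  have "avoiding F \<in> sets borel" if "finite F" for F
  proof -
    have *: "(\<lambda>\<eta>::int \<Rightarrow> bool. \<eta> i) \<in> borel_measurable borel" for i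
      by (intro borel_measurable_continuous_onI continuous_on_product_coordinates)
    have "avoiding {i} \<in> sets borel" for i
    proof -
      have "(\<lambda>\<eta>::int \<Rightarrow> bool. \<eta> i) -` {False} \<inter> space borel \<in> sets borel"
        by (rule measurable_sets[OF *]) (auto intro: borel_closed)
      also have "(\<lambda>\<eta>::int \<Rightarrow> bool. \<eta> i) -` {False} \<inter> space borel = avoiding {i}"
        by (auto simp: avoiding_def)
      finally show ?thesis .
    qed
    moreover have "avoiding F = space borel \<inter> (\<Inter>i\<in>F. avoiding {i})"
      by (auto simp: avoiding_def)
    ultimately show ?thesis
      using that by (cases "F = {}") (auto intro!: sets.finite_INT)
  qed
  then show "sigma_sets UNIV (avoiding ` Collect finite) \<subseteq> sets (borel :: (int \<Rightarrow> bool) measure)"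
    by (intro sets.sigma_sets_subset[of _ borel, simplified]) auto
qed

lemma avoiding_sets [measurable]: "finite F \<Longrightarrow> avoiding F \<in> sets borel"
  unfolding sets_borel_avoiding by (intro sigma_sets.Basic) simp

lemma measurable_avoidingI:
  assumes "\<And>i. {x \<in> space M. X x i} \<in> sets M"
  shows "X \<in> measurable M (borel :: (int \<Rightarrow> bool) measure)"
proof (rule measurable_sigma_sets[OF sets_borel_avoiding])
  fix A assume "A \<in> avoiding ` Collect finite"
  then obtain F where F: "finite F" "A = avoiding F" by auto
  have "X -` A \<inter> space M = space M - (\<Union>i\<in>F. {x \<in> space M. X x i})"
    by (auto simp: F avoiding_def)
  then show "X -` A \<inter> space M \<in> sets M"
    using F(1) assms by auto
qed auto

lemma coordinate_sets: "{\<eta>. \<eta> i} \<in> sets (borel :: (int \<Rightarrow> bool) measure)"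
proof -
  have "{\<eta>. \<eta> i} = space borel - avoiding {i}" by (auto simp: avoiding_def)
  then show ?thesis by (simp add: sets.compl_sets)
qed

lemma measure_eqI_avoiding:
  assumes "finite_measure M" "finite_measure N" "sets M = sets borel" "sets N = sets borel"
    and "\<And>F. finite F \<Longrightarrow> measure M (avoiding F) = measure N (avoiding F)"
  shows "M = N"
proof -
  interpret M: finite_measure M by fact
  interpret N: finite_measure N by fact
  show ?thesis
  proof (rule measure_eqI_generator_eq[OF Int_stable_avoiding, where \<Omega> = UNIV])
    \<comment> \<open>\<open>avoiding {}\<close> is the whole space, so a constant sequence exhausts
      it.\<close>
    show "range (\<lambda>_::nat. avoiding {}) \<subseteq> avoiding ` Collect finite" by auto
    show "(\<Union>i::nat. avoiding {}) = UNIV" by (auto simp: avoiding_def)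
    show "emeasure M X = emeasure N X" if "X \<in> avoiding ` Collect finite" for X
      using that assms(5) by (auto simp: M.emeasure_eq_measure N.emeasure_eq_measure)
  qed (use assms(3,4) in \<open>auto simp: sets_borel_avoiding\<close>)
qed

lemma funpow_shift: "(shift ^^ k) \<eta> i = \<eta> (i + int k)"
  by (induction k arbitrary: i) (auto simp: shift_def algebra_simps)

lemma shift_vimage_avoiding: "(shift ^^ k) -` avoiding F = avoiding ((\<lambda>i. i + int k) ` F)"
  by (auto simp: avoiding_def funpow_shift)

lemma measurable_shift: "shift \<in> measurable borel borel"
  using coordinate_sets by (intro measurable_avoidingI) (simp add: shift_def)

lemma distr_shift_eqI:
  assumes "prob_space \<mu>" "sets \<mu> = sets borel"
    and inv: "\<And>F. finite F \<Longrightarrow>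
      measure \<mu> (avoiding ((\<lambda>i. i + 1) ` F)) = measure \<mu> (avoiding F)"
  shows "distr \<mu> \<mu> shift = \<mu>"
proof -
  interpret prob_space \<mu> by fact
  have meas: "shift \<in> measurable \<mu> \<mu>"
    using measurable_shift assms(2) by (simp cong: measurable_cong_sets)
  have space: "space \<mu> = UNIV"
    using sets_eq_imp_space_eq[OF assms(2)] by simp
  show ?thesis
  proof (rule measure_eqI_avoiding)
    show "finite_measure (distr \<mu> \<mu> shift)"
      using prob_space_distr[OF meas] by (simp add: prob_space_def)
    show "measure (distr \<mu> \<mu> shift) (avoiding F) = prob (avoiding F)" if "finite F" for F
      using that inv[OF that] shift_vimage_avoiding[of 1 F] assms(2)
      by (simp add: measure_distr[OF meas] space)
  qed (use assms(2) in \<open>auto intro: finite_measure_axioms\<close>)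
qed

text \<open>Shifting a void event translates its finite set, and intersecting two void events unites
  their sets; mixing on the generator thus becomes a statement about void probabilities
  alone.\<close>

lemma shift_ergodicI:
  assumes "prob_space \<mu>" "sets \<mu> = sets borel"
    and inv: "\<And>F. finite F \<Longrightarrow>
      measure \<mu> (avoiding ((\<lambda>i. i + 1) ` F)) = measure \<mu> (avoiding F)"
    and mixing: "\<And>F G. finite F \<Longrightarrow> finite G \<Longrightarrow>
      (\<lambda>n. (\<Sum>k<n. measure \<mu> (avoiding (F \<union> (\<lambda>i. i + int k) ` G))) / real n)
        \<longlonglongrightarrow> measure \<mu> (avoiding F) * measure \<mu> (avoiding G)"
  shows "shift_ergodic \<mu>"
proof -
  interpret prob_space \<mu> by fact
  have meas: "shift \<in> measurable \<mu> \<mu>"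
    using measurable_shift assms(2) by (simp cong: measurable_cong_sets)
  have space: "space \<mu> = UNIV"
    using sets_eq_imp_space_eq[OF assms(2)] by simp
  have distr: "distr \<mu> \<mu> shift = \<mu>"
    using assms(1-3) by (rule distr_shift_eqI)
  have "prob A = 0 \<or> prob A = 1" if "A \<in> events" "shift -` A \<inter> space \<mu> = A" for A
  proof (rule invariant_event_0_1[OF meas distr Int_stable_avoiding _ _ _ that])
    show "events = sigma_sets (space \<mu>) (avoiding ` Collect finite)"
      by (simp add: assms(2) sets_borel_avoiding space)
    show "(\<lambda>n. (\<Sum>k<n. prob (A \<inter> (shift ^^ k) -` B)) / real n) \<longlonglongrightarrow> prob A * prob B"
      if "A \<in> avoiding ` Collect finite" "B \<in> avoiding ` Collect finite" for A B
      using that mixing by (auto simp: shift_vimage_avoiding avoiding_Un)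
  qed (simp add: space)
  with distr show ?thesis by (simp add: shift_ergodic_def)
qed

text \<open>The two-sided shift is invertible, and the backward shift serves as the left inverse
  R.\<close>

lemma shift_ergodic_absolutely_continuous_unique:
  assumes "prob_space \<mu>" "sets \<mu> = sets borel" "shift_ergodic \<mu>"
    and "prob_space \<rho>" "sets \<rho> = sets borel" "distr \<rho> \<rho> shift = \<rho>" "absolutely_continuous \<mu> \<rho>"
  shows "\<rho> = \<mu>"
proof -
  interpret prob_space \<mu> by fact
  have "(\<lambda>\<eta> i. \<eta> (i - 1)) \<in> measurable borel (borel :: (int \<Rightarrow> bool) measure)"
    using coordinate_sets by (intro measurable_avoidingI) simp
  then have R: "(\<lambda>\<eta> i. \<eta> (i - 1)) \<in> measurable \<mu> \<mu>"
    using assms(2) by (simp cong: measurable_cong_sets)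
  have T: "shift \<in> measurable \<mu> \<mu>"
    using measurable_shift assms(2) by (simp cong: measurable_cong_sets)
  show ?thesis
  proof (rule ergodic_absolutely_continuous_unique[OF T _ R])
    show "distr \<mu> \<mu> shift = \<mu>"
      using assms(3) by (simp add: shift_ergodic_def)
    show "prob A = 0 \<or> prob A = 1" if "A \<in> events" "shift -` A \<inter> space \<mu> = A" for A
      using assms(3) that by (simp add: shift_ergodic_def)
  qed (use assms in \<open>simp_all add: shift_def\<close>)
qed

section \<open>Upper density and invariant intensities\<close>

text \<open>Dual to \<open>avoiding\<close>: a union of sets misses F exactly when none of them
  belongs to \<open>hitting F\<close>.\<close>

definition hitting :: "int set \<Rightarrow> int set set" where
  "hitting F = {T. \<exists>i\<in>F. i \<in> T}"

lemma hitting_Un: "hitting (F \<union> G) = hitting F \<union> hitting G"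
  by (auto simp: hitting_def)

lemma mem_hitting_single [simp]: "T \<in> hitting {i} \<longleftrightarrow> i \<in> T"
  by (simp add: hitting_def)

lemma containing_zero_eq: "containing_zero = hitting {0}"
  by (auto simp: containing_zero_def)

lemma mem_translate [simp]: "i \<in> translate n T \<longleftrightarrow> i - n \<in> T"
  by (force simp: translate_def)

lemma translate_translate: "translate m (translate n T) = translate (m + n) T"
  by (auto simp: algebra_simps)

lemma translate_0 [simp]: "translate 0 T = T"
  by auto

lemma translate_vimage_hitting: "translate n -` hitting F = hitting ((\<lambda>i. i - n) ` F)"
  by (auto simp: hitting_def)

lemma space_nonempty_subsets_borel: "space nonempty_subsets_borel = - {{}}"
  by (simp add: nonempty_subsets_borel_def space_restrict_space subsets_borel_def)

lemma measurable_nonempty_subsets_borelI: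
  assumes "\<And>x. x \<in> space M \<Longrightarrow> f x \<noteq> {}"
    and "\<And>i. {x \<in> space M. i \<in> f x} \<in> sets M"
  shows "f \<in> measurable M nonempty_subsets_borel"
  unfolding nonempty_subsets_borel_def subsets_borel_def
proof (rule measurable_restrict_space2)
  show "f \<in> measurable M (vimage_algebra UNIV (\<lambda>T i. i \<in> T) (borel :: (int \<Rightarrow> bool) measure))"
    by (rule measurable_vimage_algebra2) (auto intro: measurable_avoidingI assms(2))
qed (use assms(1) in auto)

lemma hitting_single_sets: "hitting {i} \<in> sets nonempty_subsets_borel"
proof -
  have "(\<lambda>T i. i \<in> T) \<in> measurable nonempty_subsets_borel (borel :: (int \<Rightarrow> bool) measure)"
    unfolding nonempty_subsets_borel_def subsets_borel_def
    by (intro measurable_restrict_space1 measurable_vimage_algebra1) auto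
  from measurable_sets[OF this coordinate_sets[of i]]
  have "(\<lambda>T i. i \<in> T) -` {\<eta>. \<eta> i} \<inter> space nonempty_subsets_borel \<in> sets nonempty_subsets_borel" .
  also have "(\<lambda>T i. i \<in> T) -` {\<eta>. \<eta> i} \<inter> space nonempty_subsets_borel = hitting {i}"
    by (auto simp: space_nonempty_subsets_borel)
  finally show ?thesis .
qed

lemma hitting_sets: "hitting F \<in> sets nonempty_subsets_borel"
proof -
  have "hitting F = (\<Union>i\<in>F. hitting {i})" by (auto simp: hitting_def)
  then show ?thesis using hitting_single_sets by (auto intro!: sets.countable_UN')
qed

lemma measurable_translate: "translate n \<in> measurable nonempty_subsets_borel nonempty_subsets_borel"
proof (rule measurable_nonempty_subsets_borelI)
  fix i
  have "{T \<in> space nonempty_subsets_borel. i \<in> translate n T} = hitting {i - n}"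
    by (auto simp: space_nonempty_subsets_borel)
  then show "{T \<in> space nonempty_subsets_borel. i \<in> translate n T} \<in> sets nonempty_subsets_borel"
    by (simp add: hitting_single_sets)
qed (auto simp: space_nonempty_subsets_borel translate_def)

section \<open>Upper density and counting of heavy windows\<close>

definition initial_count :: "nat \<Rightarrow> int set \<Rightarrow> real" where
  "initial_count n T = (\<Sum>k<n. of_bool (int k \<in> T))"

text \<open>Taken in the extended reals, the limsup is available for every set; the window is
  one-sided, as in \<open>zero_density\<close>.\<close>

definition upper_density :: "int set \<Rightarrow> ereal" where
  "upper_density T = limsup (\<lambda>n. ereal ((1 / real n) * initial_count n T))"

lemma initial_count_indicator: "initial_count n T = (\<Sum>k<n. indicator (hitting {int k}) T)"
  unfolding initial_count_def by (intro sum.cong) (auto split: split_indicator)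

lemma initial_count_nonneg: "0 \<le> initial_count n T"
  by (simp add: initial_count_def sum_nonneg)

lemma initial_count_le: "initial_count n T \<le> real n"
  using sum_bounded_above[of "{..<n}" "\<lambda>k. of_bool (int k \<in> T)" "1::real"]
  by (simp add: initial_count_def)

lemma average_le_1: "(1 / real n) * initial_count n T \<le> 1"
  using initial_count_le[of n T] by (cases "n = 0") (simp_all add: divide_le_eq_1)

lemma upper_density_nonneg: "0 \<le> upper_density T"
  unfolding upper_density_def
  by (intro le_Limsup always_eventually) (auto simp: initial_count_nonneg)

text \<open>The averages are nonnegative, so a vanishing limsup already forces convergence. This
  replaces a statement about limits by a function that is measurable and translation
  invariant.\<close>

lemma zero_density_iff: "T \<in> zero_density \<longleftrightarrow> upper_density T = 0"
proof
  assume "T \<in> zero_density"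
  then have "(\<lambda>n. ereal ((1 / real n) * initial_count n T)) \<longlonglongrightarrow> ereal 0"
    by (simp add: zero_density_def initial_count_def)
  from lim_imp_Limsup[OF trivial_limit_sequentially this] show "upper_density T = 0"
    by (simp add: upper_density_def)
next
  assume *: "upper_density T = 0"
  have "0 \<le> liminf (\<lambda>n. ereal ((1 / real n) * initial_count n T))"
    by (intro Liminf_bounded always_eventually) (auto simp: initial_count_nonneg)
  moreover have "liminf (\<lambda>n. ereal ((1 / real n) * initial_count n T)) \<le> 0"
    using Liminf_le_Limsup[OF trivial_limit_sequentially,
        of "\<lambda>n. ereal ((1 / real n) * initial_count n T)"] *
    by (simp add: upper_density_def)
  ultimately have "liminf (\<lambda>n. ereal ((1 / real n) * initial_count n T)) = 0"
    by (rule antisym[rotated])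
  from Liminf_eq_Limsup[OF trivial_limit_sequentially this] *
  have "(\<lambda>n. ereal ((1 / real n) * initial_count n T)) \<longlonglongrightarrow> ereal 0"
    by (simp add: upper_density_def zero_ereal_def)
  then show "T \<in> zero_density"
    by (simp add: zero_density_def initial_count_def)
qed

text \<open>Moving the window from 0, ..., n - 1 to 1, ..., n gains the point n and loses the point
  0, a change of at most 1 that disappears after division by n.\<close>

lemma upper_density_translate_minus_1: "upper_density (translate (- 1) T) = upper_density T"
proof -
  define d where "d n = (1 / real n) * (of_bool (int n \<in> T) - of_bool (0 \<in> T))" for n
  have eq: "initial_count n (translate (- 1) T) =
      initial_count n T + (of_bool (int n \<in> T) - of_bool (0 \<in> T))" for n
    using sum.lessThan_Suc_shift[of "\<lambda>k. of_bool (int k \<in> T) :: real" n]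
    by (simp add: initial_count_def add.commute)
  have "ereal ((1 / real n) * initial_count n (translate (- 1) T)) =
      ereal (d n) + ereal ((1 / real n) * initial_count n T)" for n
    unfolding eq d_def by (simp only: plus_ereal.simps distrib_left add.commute)
  then have "upper_density (translate (- 1) T) =
      limsup (\<lambda>n. ereal (d n) + ereal ((1 / real n) * initial_count n T))"
    by (simp only: upper_density_def)
  also have "\<dots> = 0 + upper_density T"
    unfolding upper_density_def
  proof (rule ereal_limsup_lim_add)
    have "d \<longlonglongrightarrow> 0"
    proof (rule Lim_null_comparison)
      show "\<forall>\<^sub>F n in sequentially. norm (d n) \<le> 1 / real n"
        by (rule always_eventually) (auto simp: d_def)
      show "(\<lambda>n. 1 / real n) \<longlonglongrightarrow> 0" by (rule lim_1_over_n)
    qed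
    then show "(\<lambda>n. ereal (d n)) \<longlonglongrightarrow> 0" by (simp add: zero_ereal_def)
  qed simp
  finally show ?thesis by simp
qed

lemma upper_density_translate: "upper_density (translate n T) = upper_density T"
proof -
  have neg: "upper_density (translate (- int k) T) = upper_density T" for k T
  proof (induction k arbitrary: T)
    case (Suc k)
    have "translate (- int (Suc k)) T = translate (- 1) (translate (- int k) T)"
      unfolding translate_translate by simp
    then show ?case by (simp only: upper_density_translate_minus_1 Suc)
  qed simp
  show ?thesis
  proof (cases "n \<le> 0")
    case True
    then show ?thesis using neg[of "nat (- n)" T] by simp
  next
    case False
    \<comment> \<open>A positive translation is undone by the negative one just treated.\<close>
    then show ?thesis using neg[of "nat n" "translate n T"] by (simp add: translate_translate)
  qed
qed

text \<open>Greedy selection of disjoint windows: from the left, jump over a heavy window whenever one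
  starts at the current position.\<close>

lemma card_heavy_starts_le:
  fixes a :: "nat \<Rightarrow> real"
  assumes a: "\<And>k. 0 \<le> a k" and \<alpha>: "0 \<le> \<alpha>"
  shows "\<alpha> * real (card {i \<in> {s..<s + L}. \<exists>n\<in>{1..N}. \<alpha> * real n < sum a {i..<i + n}})
    \<le> sum a {s..<s + L + N}"
proof (induction L arbitrary: s rule: less_induct)
  case (less L)
  define heavy where "heavy i n \<longleftrightarrow> n \<in> {1..N} \<and> \<alpha> * real n < sum a {i..<i + n}" for i n
  define H where "H s L = {i \<in> {s..<s + L}. \<exists>n. heavy i n}" for s L
  have IH: "\<alpha> * real (card (H s l)) \<le> sum a {s..<s + l + N}" if "l < L" for s l
    using less[OF that, of s] by (simp add: H_def heavy_def Bex_def conj_assoc)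
  have "\<alpha> * real (card (H s L)) \<le> sum a {s..<s + L + N}"
  proof (cases "L = 0")
    case True
    then show ?thesis by (simp add: H_def sum_nonneg a)
  next
    case L: False
    show ?thesis
    proof (cases "\<exists>n. heavy s n")
      case False
      then have "H s L = H (Suc s) (L - 1)"
        using L by (auto simp: H_def) (metis Suc_leI le_neq_implies_less)
      also have "\<alpha> * real (card (H (Suc s) (L - 1))) \<le> sum a {Suc s..<Suc s + (L - 1) + N}"
        using L by (intro IH) simp
      also have "\<dots> \<le> sum a {s..<s + L + N}"
        using L by (intro sum_mono2 a) auto
      finally show ?thesis .
    next
      case True
      then obtain n where n: "1 \<le> n" "n \<le> N" "\<alpha> * real n < sum a {s..<s + n}"
        by (auto simp: heavy_def)
      show ?thesis
      proof (cases "n < L")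
        case False
        \<comment> \<open>The heavy window covers all L candidate starts. It may overshoot their
          range, but by at most N since its length is at most N; the extra N on the right absorbs
          this.\<close>
        have "card (H s L) \<le> card {s..<s + L}"
          by (rule card_mono) (auto simp: H_def)
        then have "\<alpha> * real (card (H s L)) \<le> \<alpha> * real n"
          using False \<alpha> by (intro mult_left_mono) auto
        also have "\<dots> \<le> sum a {s..<s + n}" using n(3) by simp
        also have "\<dots> \<le> sum a {s..<s + L + N}"
          using n(2) by (intro sum_mono2 a) auto
        finally show ?thesis .
      next
        case True
        \<comment> \<open>At most n starts lie inside the heavy window, and they are paid for by the
          sum over that window; the induction hypothesis handles the rest on a disjoint
          range.\<close>
        have "H s L \<subseteq> {s..<s + n} \<union> H (s + n) (L - n)"
          using True by (auto simp: H_def)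
        then have "card (H s L) \<le> card ({s..<s + n} \<union> H (s + n) (L - n))"
          by (rule card_mono[rotated]) (simp add: H_def)
        also have "\<dots> \<le> n + card (H (s + n) (L - n))"
          using card_Un_le[of "{s..<s + n}" "H (s + n) (L - n)"] by simp
        finally have "\<alpha> * real (card (H s L)) \<le> \<alpha> * real (n + card (H (s + n) (L - n)))"
          using \<alpha> by (intro mult_left_mono) auto
        also have "\<dots> = \<alpha> * real n + \<alpha> * real (card (H (s + n) (L - n)))"
          by (simp add: algebra_simps)
        also have "\<dots> \<le> sum a {s..<s + n} + sum a {s + n..<s + n + (L - n) + N}"
          using n True by (intro add_mono IH) auto
        also have "\<dots> = sum a {s..<s + L + N}"
          using True by (simp add: sum.atLeastLessThan_concat)
        finally show ?thesis .
      qed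
    qed
  qed
  then show ?case by (simp add: H_def heavy_def Bex_def conj_assoc)
qed

section \<open>Translation-invariant intensities and the maximal inequality\<close>

text \<open>Kept as a locale because its facts are needed both for \<nu> and for a finite invariant
  summand of \<nu>.\<close>

locale invariant_intensity =
  fixes \<nu> :: "int set measure"
  assumes sets_eq: "sets \<nu> = sets nonempty_subsets_borel"
    and invariant: "translation_invariant \<nu>"
begin

lemma space_eq: "space \<nu> = - {{}}"
  using sets_eq_imp_space_eq[OF sets_eq] by (simp add: space_nonempty_subsets_borel)

lemma hitting_in_sets [measurable, simp]: "hitting F \<in> sets \<nu>"
  using hitting_sets by (simp add: sets_eq)

lemma translate_measurable [measurable]: "translate n \<in> measurable \<nu> \<nu>"
  using measurable_translate[of n] by (simp add: sets_eq cong: measurable_cong_sets)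

lemma emeasure_translate:
  assumes "A \<in> sets \<nu>"
  shows "emeasure \<nu> (translate n -` A \<inter> space \<nu>) = emeasure \<nu> A"
proof -
  have "emeasure (distr \<nu> \<nu> (translate n)) A = emeasure \<nu> (translate n -` A \<inter> space \<nu>)"
    using assms by (intro emeasure_distr) auto
  then show ?thesis
    using invariant by (simp add: translation_invariant_def)
qed

lemma hitting_Int_space [simp]: "hitting F \<inter> space \<nu> = hitting F"
  by (auto simp: space_eq hitting_def)

lemma emeasure_hitting_Int_shift:
  "emeasure \<nu> (hitting ((\<lambda>i. i + n) ` F) \<inter> hitting ((\<lambda>i. i + n) ` G)) =
    emeasure \<nu> (hitting F \<inter> hitting G)"
proof -
  have "translate n -` (hitting ((\<lambda>i. i + n) ` F) \<inter> hitting ((\<lambda>i. i + n) ` G)) \<inter> space \<nu>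
      = hitting F \<inter> hitting G"
    by (auto simp: translate_vimage_hitting image_image space_eq hitting_def)
  then show ?thesis
    using emeasure_translate[of "hitting ((\<lambda>i. i + n) ` F) \<inter> hitting ((\<lambda>i. i + n) ` G)" n] by simp
qed

lemma emeasure_hitting_shift: "emeasure \<nu> (hitting ((\<lambda>i. i + n) ` F)) = emeasure \<nu> (hitting F)"
  using emeasure_hitting_Int_shift[of n F F] by simp

lemma emeasure_hitting_single: "emeasure \<nu> (hitting {i}) = emeasure \<nu> (hitting {0})"
  using emeasure_hitting_shift[of i "{0}"] by simp

lemma emeasure_hitting_finite:
  assumes "emeasure \<nu> (hitting {0}) < \<infinity>" "finite F"
  shows "emeasure \<nu> (hitting F) < \<infinity>"
  using assms(2)
proof (induction F)
  case (insert i F)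
  have "emeasure \<nu> (hitting (insert i F)) \<le> emeasure \<nu> (hitting {i}) + emeasure \<nu> (hitting F)"
    using hitting_Un[of "{i}" F] by (simp add: emeasure_subadditive)
  then show ?case
    using insert assms(1) emeasure_hitting_single[of i] by (simp add: order.strict_trans1)
qed (simp add: hitting_def)

lemma hitting_fmeasurable:
  "emeasure \<nu> (hitting {0}) < \<infinity> \<Longrightarrow> finite F \<Longrightarrow> hitting F \<in> fmeasurable \<nu>"
  using emeasure_hitting_finite by (intro fmeasurableI) auto

lemma of_bool_measurable [measurable]: "(\<lambda>T. of_bool (i \<in> T) :: real) \<in> borel_measurable \<nu>"
proof -
  have "(\<lambda>T. of_bool (i \<in> T) :: real) = indicator (hitting {i})"
    by (auto simp: fun_eq_iff split: split_indicator)
  then show ?thesis by simp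
qed

lemma initial_count_measurable [measurable]: "initial_count n \<in> borel_measurable \<nu>"
  unfolding initial_count_def[abs_def] by measurable

lemma upper_density_measurable [measurable]: "upper_density \<in> borel_measurable \<nu>"
  unfolding upper_density_def[abs_def] by measurable

lemma zero_density_compl_sets: "space \<nu> - zero_density \<in> sets \<nu>"
proof -
  have "space \<nu> - zero_density = {T \<in> space \<nu>. upper_density T \<noteq> 0}"
    by (auto simp: zero_density_iff)
  then show ?thesis by simp
qed

lemma AE_zero_density:
  "emeasure \<nu> (space \<nu> - zero_density) = 0 \<Longrightarrow> AE T in \<nu>. T \<in> zero_density"
  using zero_density_compl_sets by (intro AE_I[of _ _ "space \<nu> - zero_density"]) auto

text \<open>The constant \<open>2\<close> of this weak-type bound comes from taking \<open>L = N\<close> in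
  \<open>card_heavy_starts_le\<close>.\<close>

lemma maximal_inequality_truncated:
  assumes \<alpha>: "0 \<le> \<alpha>"
  shows "ennreal \<alpha> * emeasure \<nu> {T \<in> space \<nu>. \<exists>n\<in>{1..N}. \<alpha> * real n < initial_count n T}
    \<le> 2 * emeasure \<nu> (hitting {0})"
proof (cases "N = 0")
  case False
  define D where "D = {T \<in> space \<nu>. \<exists>n\<in>{1..N}. \<alpha> * real n < initial_count n T}"
  have D[measurable]: "D \<in> sets \<nu>" unfolding D_def by measurable
  \<comment> \<open>\<open>D' i\<close> says that a heavy window starts at position i; by invariance
    its measure does not depend on i.\<close>
  define D' where "D' i = translate (- int i) -` D \<inter> space \<nu>" for i
  have D'[measurable]: "D' i \<in> sets \<nu>" for i
    unfolding D'_def by measurable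
  have window: "initial_count n (translate (- int i) T) = (\<Sum>k\<in>{i..<i + n}. of_bool (int k \<in> T))"
    for n i T
    using sum.shift_bounds_nat_ivl[of "\<lambda>k. of_bool (int k \<in> T) :: real" 0 i n]
    by (simp add: initial_count_def atLeast0LessThan add.commute)
  have D'_iff: "T \<in> D' i \<longleftrightarrow>
      (\<exists>n\<in>{1..N}. \<alpha> * real n < (\<Sum>k\<in>{i..<i + n}. of_bool (int k \<in> T)))" if "T \<in> space \<nu>" for T i
    using that measurable_space[OF translate_measurable that]
    by (simp add: D'_def D_def window)
  have pointwise: "ennreal \<alpha> * (\<Sum>i<N. indicator (D' i) T) \<le> (\<Sum>k<N + N. indicator (hitting {int k}) T)"
    if T: "T \<in> space \<nu>" for T
  proof -
    have "\<alpha> * (\<Sum>i<N. indicator (D' i) T) = \<alpha> * real (card {i \<in> {0..<0 + N}.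
        \<exists>n\<in>{1..N}. \<alpha> * real n < (\<Sum>k\<in>{i..<i + n}. of_bool (int k \<in> T))})"
    proof -
      have "{i \<in> {0..<0 + N}. \<exists>n\<in>{1..N}. \<alpha> * real n < (\<Sum>k\<in>{i..<i + n}. of_bool (int k \<in> T))}
          = {..<N} \<inter> {i. T \<in> D' i}"
        unfolding D'_iff[OF T] by auto
      then show ?thesis by (simp only:) (simp add: indicator_def)
    qed
    also have "\<dots> \<le> (\<Sum>k\<in>{0..<0 + N + N}. of_bool (int k \<in> T))"
      by (rule card_heavy_starts_le) (use \<alpha> in auto)
    also have "\<dots> = (\<Sum>k<N + N. indicator (hitting {int k}) T)"
      by (intro sum.cong) (auto split: split_indicator)
    finally have "ennreal (\<alpha> * (\<Sum>i<N. indicator (D' i) T))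
        \<le> ennreal (\<Sum>k<N + N. indicator (hitting {int k}) T)"
      by (rule ennreal_leI)
    then show ?thesis
      using \<alpha> by (simp add: ennreal_mult sum_nonneg sum_ennreal[symmetric] ennreal_indicator)
  qed
  \<comment> \<open>Integration of the pointwise bound gives N copies of the measure of D on the
    left and 2N copies of the measure of \<open>hitting {0}\<close> on the right; N then
    cancels.\<close>
  have "of_nat N * (ennreal \<alpha> * emeasure \<nu> D) = ennreal \<alpha> * (\<Sum>i<N. emeasure \<nu> (D' i))"
    using emeasure_translate[OF D] by (simp only: D'_def sum_constant card_lessThan ac_simps)
  also have "\<dots> = (\<integral>\<^sup>+T. ennreal \<alpha> * (\<Sum>i<N. indicator (D' i) T) \<partial>\<nu>)"
    by (simp add: nn_integral_cmult nn_integral_sum)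
  also have "\<dots> \<le> (\<integral>\<^sup>+T. (\<Sum>k<N + N. indicator (hitting {int k}) T) \<partial>\<nu>)"
    by (intro nn_integral_mono pointwise)
  also have "\<dots> = (\<Sum>k<N + N. emeasure \<nu> (hitting {int k}))"
    by (simp add: nn_integral_sum)
  also have "\<dots> = (\<Sum>k<N + N. emeasure \<nu> (hitting {0}))"
    by (intro sum.cong refl emeasure_hitting_single)
  also have "\<dots> = of_nat N * (2 * emeasure \<nu> (hitting {0}))"
    by (simp add: mult_2 distrib_left distrib_right)
  finally show ?thesis
    using False by (simp add: D_def ennreal_mult_le_mult_iff of_nat_less_top)
qed simp

text \<open>Upper density above \<alpha> forces some initial window with average above \<alpha>. The
  truncated maximal inequality has a bound free of N, so it survives the increasing limit in
  N.\<close>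

lemma emeasure_upper_density_greater:
  assumes fin: "emeasure \<nu> (hitting {0}) < \<infinity>" and \<alpha>: "0 < \<alpha>"
  shows "emeasure \<nu> {T \<in> space \<nu>. ereal \<alpha> < upper_density T} < \<infinity>"
proof -
  define D where "D N = {T \<in> space \<nu>. \<exists>n\<in>{1..N}. \<alpha> * real n < initial_count n T}" for N
  have [measurable]: "D N \<in> sets \<nu>" for N unfolding D_def by measurable
  have "{T \<in> space \<nu>. ereal \<alpha> < upper_density T} \<subseteq> (\<Union>N. D N)"
  proof safe
    fix T assume T: "T \<in> space \<nu>" "ereal \<alpha> < upper_density T"
    have "\<exists>n\<ge>1. \<alpha> < (1 / real n) * initial_count n T"
    proof (rule ccontr)
      assume "\<not> ?thesis"
      then have "upper_density T \<le> ereal \<alpha>"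
        unfolding upper_density_def
        by (intro Limsup_bounded eventually_sequentiallyI[of 1]) (auto simp: not_less)
      with T(2) show False by simp
    qed
    then obtain n where "1 \<le> n" "\<alpha> * real n < initial_count n T"
      by (auto simp: field_simps)
    then have "T \<in> D n" using T(1) by (auto simp: D_def)
    then show "T \<in> (\<Union>N. D N)" by blast
  qed
  then have "ennreal \<alpha> * emeasure \<nu> {T \<in> space \<nu>. ereal \<alpha> < upper_density T}
      \<le> ennreal \<alpha> * emeasure \<nu> (\<Union>N. D N)"
    by (intro mult_left_mono emeasure_mono) auto
  also have "emeasure \<nu> (\<Union>N. D N) = (SUP N. emeasure \<nu> (D N))"
  proof (rule SUP_emeasure_incseq[symmetric])
    show "incseq D"
      unfolding D_def by (intro monoI) (auto 0 4 intro: order_trans)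
  qed auto
  also have "ennreal \<alpha> * \<dots> = (SUP N. ennreal \<alpha> * emeasure \<nu> (D N))"
    by (rule SUP_mult_left_ennreal)
  also have "\<dots> \<le> 2 * emeasure \<nu> (hitting {0})"
    unfolding D_def using \<alpha> by (intro SUP_least maximal_inequality_truncated) simp
  also have "\<dots> < \<infinity>" using fin by (simp add: ennreal_mult_less_top)
  finally show ?thesis using \<alpha> by (auto simp: ennreal_mult_less_top)
qed

section \<open>Invariant sets and finite invariant parts\<close>

definition invariant_set :: "int set set \<Rightarrow> bool" where
  "invariant_set A \<longleftrightarrow> A \<in> sets \<nu> \<and> (\<forall>n. translate n -` A \<inter> space \<nu> = A)"

text \<open>Sets of positive upper density are exhausted by the countably many levels 1/(m + 1), one
  of which must be charged. That level is invariant because upper density is, and finite by the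
  maximal inequality.\<close>

lemma ex_finite_invariant_set:
  assumes fin: "emeasure \<nu> (hitting {0}) < \<infinity>"
    and pos: "emeasure \<nu> (space \<nu> - zero_density) \<noteq> 0"
  shows "\<exists>A. invariant_set A \<and> emeasure \<nu> A \<noteq> 0 \<and> emeasure \<nu> A < \<infinity>"
proof -
  define A where "A m = {T \<in> space \<nu>. ereal (1 / real (Suc m)) < upper_density T}" for m
  have [measurable]: "A m \<in> sets \<nu>" for m unfolding A_def by measurable
  have "space \<nu> - zero_density = (\<Union>m. A m)"
  proof safe
    fix T assume T: "T \<in> space \<nu>" "T \<notin> zero_density"
    then have "0 < upper_density T"
      using upper_density_nonneg[of T] by (simp add: zero_density_iff order_less_le)
    then obtain r :: real where r: "0 < ereal r" "ereal r < upper_density T"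
      using ereal_dense2[of 0 "upper_density T"] by blast
    then obtain m where "inverse (real (Suc m)) < r"
      using reals_Archimedean[of r] by auto
    then have "ereal (1 / real (Suc m)) < ereal r" by (simp add: inverse_eq_divide)
    from this r(2) have "ereal (1 / real (Suc m)) < upper_density T" by (rule order.strict_trans)
    then have "T \<in> A m" using T(1) by (simp add: A_def)
    then show "T \<in> (\<Union>m. A m)" by blast
  next
    fix T m assume "T \<in> A m" "T \<in> zero_density"
    then show False by (simp add: A_def zero_density_iff)
  qed (simp add: A_def)
  moreover have "range A \<subseteq> sets \<nu>" by auto
  ultimately obtain m where m: "emeasure \<nu> (A m) \<noteq> 0"
    using emeasure_UN_eq_0[of \<nu> A] pos by metis
  have "invariant_set (A m)"
    using measurable_space[OF translate_measurable]
    by (auto simp: invariant_set_def) (auto simp: A_def upper_density_translate)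
  moreover have "emeasure \<nu> (A m) < \<infinity>"
    unfolding A_def by (rule emeasure_upper_density_greater[OF fin]) simp
  ultimately show ?thesis using m by blast
qed

lemma invariant_set_Diff:
  assumes "invariant_set A"
  shows "invariant_set (space \<nu> - A)"
proof -
  have "translate n -` (space \<nu> - A) \<inter> space \<nu> = space \<nu> - (translate n -` A \<inter> space \<nu>)" for n
    using measurable_space[OF translate_measurable[of n]] by auto
  then show ?thesis
    using assms unfolding invariant_set_def by (metis sets.compl_sets)
qed

lemma emeasure_invariant_Int:
  assumes "invariant_set A" "B \<in> sets \<nu>"
  shows "emeasure \<nu> (A \<inter> (translate n -` B \<inter> space \<nu>)) = emeasure \<nu> (A \<inter> B)"
proof -
  have "A \<inter> (translate n -` B \<inter> space \<nu>) = translate n -` (A \<inter> B) \<inter> space \<nu>"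
    using assms(1) by (auto simp: invariant_set_def)
  moreover have "A \<inter> B \<in> sets \<nu>"
    using assms by (auto simp: invariant_set_def)
  ultimately show ?thesis by (simp only: emeasure_translate)
qed

text \<open>Restriction to A is written as a density, which retains the space and sigma-algebra of
  \<nu> as the splitting in \<open>has_finite_invariant_part\<close> demands.\<close>

lemma translation_invariant_restrict:
  assumes A: "invariant_set A"
  shows "translation_invariant (density \<nu> (indicator A))"
  unfolding translation_invariant_def
proof
  fix n
  have [measurable]: "A \<in> sets \<nu>" using A by (simp add: invariant_set_def)
  show "distr (density \<nu> (indicator A)) (density \<nu> (indicator A)) (translate n) = density \<nu> (indicator A)"
  proof (rule measure_eqI)
    fix B assume "B \<in> sets (distr (density \<nu> (indicator A)) (density \<nu> (indicator A)) (translate n))"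
    then have B[measurable]: "B \<in> sets \<nu>" by simp
    have restr: "emeasure (density \<nu> (indicator A)) C = emeasure \<nu> (A \<inter> C)" if [measurable]: "C \<in> sets \<nu>" for C
      by (simp add: emeasure_density indicator_inter_arith[symmetric])
    show "emeasure (distr (density \<nu> (indicator A)) (density \<nu> (indicator A)) (translate n)) B =
        emeasure (density \<nu> (indicator A)) B"
      by (subst emeasure_distr) (simp_all add: restr emeasure_invariant_Int[OF A B])
  qed simp
qed

text \<open>The two parts are the restrictions of \<nu> to the complement of A and to A.\<close>

lemma has_finite_invariant_partI:
  assumes A: "invariant_set A" and "emeasure \<nu> A \<noteq> 0" "emeasure \<nu> A < \<infinity>"
  shows "has_finite_invariant_part \<nu>"
  unfolding has_finite_invariant_part_def
proof (intro exI conjI)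
  have [measurable]: "A \<in> sets \<nu>" using A by (simp add: invariant_set_def)
  have restr: "emeasure (density \<nu> (indicator D)) C = emeasure \<nu> (D \<inter> C)"
    if [measurable]: "D \<in> sets \<nu>" "C \<in> sets \<nu>" for C D
    by (simp add: emeasure_density indicator_inter_arith[symmetric])
  show "translation_invariant (density \<nu> (indicator (space \<nu> - A)))"
    using A by (intro translation_invariant_restrict invariant_set_Diff)
  show "translation_invariant (density \<nu> (indicator A))"
    using A by (rule translation_invariant_restrict)
  show "\<forall>B\<in>sets \<nu>. emeasure \<nu> B =
      emeasure (density \<nu> (indicator (space \<nu> - A))) B + emeasure (density \<nu> (indicator A)) B"
  proof
    fix B assume B[measurable]: "B \<in> sets \<nu>"
    have "emeasure \<nu> ((space \<nu> - A) \<inter> B) + emeasure \<nu> (A \<inter> B)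
        = emeasure \<nu> (((space \<nu> - A) \<inter> B) \<union> (A \<inter> B))"
      by (rule plus_emeasure) auto
    also have "((space \<nu> - A) \<inter> B) \<union> (A \<inter> B) = B"
      using sets.sets_into_space[OF B] by auto
    finally show "emeasure \<nu> B =
        emeasure (density \<nu> (indicator (space \<nu> - A))) B + emeasure (density \<nu> (indicator A)) B"
      by (simp add: restr)
  qed
  have "A \<inter> space \<nu> = A" using sets.sets_into_space[of A \<nu>] by auto
  then have "emeasure (density \<nu> (indicator A)) (space (density \<nu> (indicator A))) = emeasure \<nu> A"
    by (simp add: restr)
  with assms(2,3) show "emeasure (density \<nu> (indicator A)) (space (density \<nu> (indicator A))) \<noteq> 0"
    and "finite_measure (density \<nu> (indicator A))"
    by (simp, intro finite_measureI) (simp only: infinity_ennreal_def less_top)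
qed simp_all

text \<open>Every nonempty set contains some integer, so the translates of \<open>hitting {0}\<close> cover the space.\<close>

lemma invariant_set_null:
  assumes A: "invariant_set A" and null: "emeasure \<nu> (A \<inter> hitting {0}) = 0"
  shows "emeasure \<nu> A = 0"
proof -
  have [measurable]: "A \<in> sets \<nu>" using A by (simp add: invariant_set_def)
  have "emeasure \<nu> (A \<inter> hitting {i}) = 0" for i
  proof -
    have "translate (- i) -` hitting {0} \<inter> space \<nu> = hitting {i}"
      by (simp add: translate_vimage_hitting)
    then show ?thesis
      using emeasure_invariant_Int[OF A, of "hitting {0}" "- i"] null by simp
  qed
  then have "A \<inter> hitting {i} \<in> null_sets \<nu>" for i
    by (intro null_setsI) auto
  then have "emeasure \<nu> (\<Union>i. A \<inter> hitting {i}) = 0"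
    by (intro null_setsD1 null_sets_UN)
  moreover have "(\<Union>i. A \<inter> hitting {i}) = A"
    using sets.sets_into_space[of A \<nu>] by (auto simp: space_eq) (metis ex_in_conv)
  ultimately show ?thesis by simp
qed

section \<open>Averages of intensities carried by sets of density zero\<close>

text \<open>The average is the integral over \<open>hitting {i}\<close> of the proportion of 0, ...,
  n - 1 lying in T. This proportion tends to 0 and is at most 1 on a set of finite measure, so
  dominated convergence applies.\<close>

lemma cesaro_hitting_null:
  assumes fin: "emeasure \<nu> (hitting {0}) < \<infinity>"
    and null: "emeasure \<nu> (space \<nu> - zero_density) = 0"
  shows "(\<lambda>n. (\<Sum>k<n. measure \<nu> (hitting {i} \<inter> hitting {int k})) / real n) \<longlonglongrightarrow> 0"
proof -
  define f where "f n T = indicator (hitting {i}) T * ((1 / real n) * initial_count n T)" for n T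
  have [measurable]: "f n \<in> borel_measurable \<nu>" for n unfolding f_def by measurable
  have fin': "emeasure \<nu> (hitting {i}) < \<infinity>" for i
    using fin emeasure_hitting_single[of i] by simp
  have fin2: "emeasure \<nu> (hitting {i} \<inter> hitting {j}) < \<infinity>" for i j
    using emeasure_mono[of "hitting {i} \<inter> hitting {j}" "hitting {i}" \<nu>] fin'[of i]
    by (simp add: order.strict_trans1)
  have zero: "AE T in \<nu>. T \<in> zero_density"
    using null by (rule AE_zero_density)
  have "(\<lambda>n. integral\<^sup>L \<nu> (f n)) \<longlonglongrightarrow> integral\<^sup>L \<nu> (\<lambda>_. 0 :: real)"
  proof (rule integral_dominated_convergence)
    show "integrable \<nu> (indicator (hitting {i}) :: _ \<Rightarrow> real)"
      using fin' by (intro integrable_real_indicator) auto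
    show "AE T in \<nu>. (\<lambda>n. f n T) \<longlonglongrightarrow> 0"
      using zero
    proof eventually_elim
      case (elim T)
      then have "(\<lambda>n. (1 / real n) * initial_count n T) \<longlonglongrightarrow> 0"
        by (simp add: zero_density_def initial_count_def)
      then show ?case unfolding f_def by (rule tendsto_mult_right_zero)
    qed
    show "AE T in \<nu>. norm (f n T) \<le> indicator (hitting {i}) T" for n
      using average_le_1[of n] initial_count_nonneg[of n]
      by (auto simp: f_def split: split_indicator)
  qed auto
  moreover have "integral\<^sup>L \<nu> (f n) = (\<Sum>k<n. measure \<nu> (hitting {i} \<inter> hitting {int k})) / real n" for n
  proof -
    have "f n T = (\<Sum>k<n. indicator (hitting {i} \<inter> hitting {int k}) T) / real n" for T
      by (cases "i \<in> T") (simp_all add: f_def initial_count_indicator indicator_inter_arith)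
    then have "integral\<^sup>L \<nu> (f n) =
        (\<integral>T. (\<Sum>k<n. indicator (hitting {i} \<inter> hitting {int k}) T) / real n \<partial>\<nu>)"
      by (intro Bochner_Integration.integral_cong refl)
    also have "\<dots> = (\<Sum>k<n. \<integral>T. indicator (hitting {i} \<inter> hitting {int k}) T \<partial>\<nu>) / real n"
      using fin2 by (simp add: integrable_real_indicator)
    finally show ?thesis by simp
  qed
  ultimately show ?thesis by simp
qed

end

text \<open>The part \<open>\<nu>\<^sub>2\<close> lies below \<nu>, so it too is carried by sets of
  density zero. Being finite, it admits the constant 1 as majorant: the mean proportion tends to 0,
  yet invariance makes it equal to the measure of \<open>hitting {0}\<close> for every positive
  n.\<close>

lemma not_has_finite_invariant_partI:
  assumes "invariant_intensity \<nu>" and null: "emeasure \<nu> (space \<nu> - zero_density) = 0"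
  shows "\<not> has_finite_invariant_part \<nu>"
proof
  interpret invariant_intensity \<nu> by fact
  assume "has_finite_invariant_part \<nu>"
  then obtain \<nu>\<^sub>1 \<nu>\<^sub>2 where sets2: "sets \<nu>\<^sub>2 = sets \<nu>"
    and sum: "\<And>A. A \<in> sets \<nu> \<Longrightarrow> emeasure \<nu> A = emeasure \<nu>\<^sub>1 A + emeasure \<nu>\<^sub>2 A"
    and inv2: "translation_invariant \<nu>\<^sub>2" and "finite_measure \<nu>\<^sub>2"
    and nonzero: "emeasure \<nu>\<^sub>2 (space \<nu>\<^sub>2) \<noteq> 0"
    unfolding has_finite_invariant_part_def by blast
  interpret I2: invariant_intensity \<nu>\<^sub>2
    by unfold_locales (simp_all add: sets2 sets_eq inv2)
  interpret F2: finite_measure \<nu>\<^sub>2 by fact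
  have space2: "space \<nu>\<^sub>2 = space \<nu>" using sets2 by (rule sets_eq_imp_space_eq)
  from sum[OF zero_density_compl_sets] null have null2: "emeasure \<nu>\<^sub>2 (space \<nu>\<^sub>2 - zero_density) = 0"
    by (simp add: space2)
  have measure_h: "measure \<nu>\<^sub>2 (hitting {i}) = measure \<nu>\<^sub>2 (hitting {0})" for i
    using I2.emeasure_hitting_single[of i] by (simp add: measure_def)
  have zero: "AE T in \<nu>\<^sub>2. T \<in> zero_density"
    using null2 by (rule I2.AE_zero_density)
  have "(\<lambda>n. \<integral>T. (1 / real n) * initial_count n T \<partial>\<nu>\<^sub>2) \<longlonglongrightarrow> (\<integral>T. 0 \<partial>\<nu>\<^sub>2)"
  proof (rule integral_dominated_convergence)
    show "integrable \<nu>\<^sub>2 (\<lambda>_. 1 :: real)" by simp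
    show "AE T in \<nu>\<^sub>2. (\<lambda>n. (1 / real n) * initial_count n T) \<longlonglongrightarrow> 0"
      using zero by eventually_elim (simp add: zero_density_def initial_count_def)
    show "AE T in \<nu>\<^sub>2. norm ((1 / real n) * initial_count n T) \<le> 1" for n
      using average_le_1[of n] initial_count_nonneg[of n] by auto
  qed auto
  moreover have "(\<integral>T. (1 / real n) * initial_count n T \<partial>\<nu>\<^sub>2)
      = (\<Sum>k<n. measure \<nu>\<^sub>2 (hitting {0})) / real n" for n
  proof -
    have "(1 / real n) * initial_count n T = (\<Sum>k<n. indicator (hitting {int k}) T) / real n" for T
      by (simp add: initial_count_indicator)
    then have "(\<integral>T. (1 / real n) * initial_count n T \<partial>\<nu>\<^sub>2)
        = (\<integral>T. (\<Sum>k<n. indicator (hitting {int k}) T) / real n \<partial>\<nu>\<^sub>2)" by (simp only:)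
    also have "\<dots> = (\<Sum>k<n. measure \<nu>\<^sub>2 (hitting {int k})) / real n"
      by (simp add: integrable_real_indicator F2.emeasure_finite less_top[symmetric])
    also have "\<dots> = (\<Sum>k<n. measure \<nu>\<^sub>2 (hitting {0})) / real n"
      by (intro arg_cong2[of _ _ _ _ "(/)"] sum.cong refl measure_h)
    finally show ?thesis .
  qed
  ultimately have "(\<lambda>n. (\<Sum>k<n. measure \<nu>\<^sub>2 (hitting {0})) / real n) \<longlonglongrightarrow> 0" by simp
  with cesaro_const have "measure \<nu>\<^sub>2 (hitting {0}) = 0"
    by (rule LIMSEQ_unique)
  \<comment> \<open>The whole space is an invariant set, so missing \<open>hitting {0}\<close> makes
    the part zero.\<close>
  then have "emeasure \<nu>\<^sub>2 (space \<nu>\<^sub>2 \<inter> hitting {0}) = 0"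
    by (simp add: F2.emeasure_eq_measure Int_commute)
  moreover have "I2.invariant_set (space \<nu>\<^sub>2)"
    using measurable_space[OF I2.translate_measurable] by (auto simp: I2.invariant_set_def)
  ultimately show False
    using I2.invariant_set_null nonzero by blast
qed

section \<open>The Poisson union process\<close>

context poisson_process
begin

lemma num_points_eq_0_iff: "num_points Y A \<omega> = 0 \<longleftrightarrow> ran (Y \<omega>) \<inter> A = {}"
  by (auto simp: num_points_def emeasure_count_space_eq_0 ran_def)

definition void :: "'a set \<Rightarrow> 'w set" where
  "void A = {\<omega> \<in> space M. ran (Y \<omega>) \<inter> A = {}}"

lemma void_events [measurable]:
  assumes "A \<in> sets \<nu>"
  shows "void A \<in> events"
proof -
  have [measurable]: "num_points Y A \<in> borel_measurable M"
    using assms by (rule measurable_num_points)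
  have "{\<omega> \<in> space M. num_points Y A \<omega> = 0} \<in> events" by measurable
  then show ?thesis by (simp add: void_def num_points_eq_0_iff)
qed

lemma prob_void:
  assumes "A \<in> sets \<nu>" "emeasure \<nu> A < \<infinity>"
  shows "prob (void A) = exp (- measure \<nu> A)"
  using poisson_finite[OF assms, of 0] by (simp add: void_def num_points_eq_0_iff)

lemma void_Un: "void (A \<union> B) = void A \<inter> void B"
  by (auto simp: void_def)

end

locale invariant_poisson = invariant_intensity \<nu> + poisson_process M \<nu> Y
  for \<nu> :: "int set measure" and M :: "'w measure" and Y :: "'w \<Rightarrow> nat \<rightharpoonup> int set"
begin

lemma union_process_vimage_avoiding:
  "union_process Y -` avoiding F \<inter> space M = void (hitting F)"
  by (auto simp: avoiding_def void_def union_process_def hitting_def)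

lemma union_process_measurable [measurable]: "union_process Y \<in> measurable M borel"
proof (rule measurable_avoidingI)
  fix i
  have "{\<omega> \<in> space M. union_process Y \<omega> i} = space M - void (hitting {i})"
    by (auto simp: void_def union_process_def)
  then show "{\<omega> \<in> space M. union_process Y \<omega> i} \<in> events" by auto
qed

text \<open>With finite intensity the site 0 stays uncovered with positive probability. With
  infinite intensity invariance covers each site almost surely, hence all countably many sites at
  once.\<close>

lemma prob_full_less_1_iff:
  "prob {\<omega> \<in> space M. \<forall>i. union_process Y \<omega> i} < 1 \<longleftrightarrow> emeasure \<nu> (hitting {0}) < \<infinity>"
proof
  have full: "{\<omega> \<in> space M. \<forall>i. union_process Y \<omega> i} = space M - (\<Union>i. void (hitting {i}))"
    by (fastforce simp: void_def union_process_def hitting_def)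
  {
    assume fin: "emeasure \<nu> (hitting {0}) < \<infinity>"
    have "prob {\<omega> \<in> space M. \<forall>i. union_process Y \<omega> i} \<le> prob (space M - void (hitting {0}))"
      by (rule finite_measure_mono) (auto simp: full)
    also have "\<dots> = 1 - exp (- measure \<nu> (hitting {0}))"
      using fin by (simp add: prob_compl prob_void)
    also have "\<dots> < 1" by simp
    finally show "prob {\<omega> \<in> space M. \<forall>i. union_process Y \<omega> i} < 1" .
  }
  show "emeasure \<nu> (hitting {0}) < \<infinity>" if less: "prob {\<omega> \<in> space M. \<forall>i. union_process Y \<omega> i} < 1"
  proof (rule ccontr)
    assume "\<not> emeasure \<nu> (hitting {0}) < \<infinity>"
    then have "emeasure \<nu> (hitting {i}) = \<infinity>" for i
      using emeasure_hitting_single[of i] by (metis infinity_ennreal_def top.not_eq_extremum)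
    then have "AE \<omega> in M. num_points Y (hitting {i}) \<omega> = \<infinity>" for i
      by (intro poisson_infinite) auto
    then have "AE \<omega> in M. \<forall>i. num_points Y (hitting {i}) \<omega> = \<infinity>"
      by (simp add: AE_all_countable)
    then have "AE \<omega> in M. \<omega> \<in> {\<omega> \<in> space M. \<forall>i. union_process Y \<omega> i}"
      using AE_space
    proof eventually_elim
      case (elim \<omega>)
      then have "num_points Y (hitting {i}) \<omega> \<noteq> 0" for i by simp
      then show ?case using elim(2) by (auto simp: full num_points_eq_0_iff void_def)
    qed
    moreover have "{\<omega> \<in> space M. \<forall>i. union_process Y \<omega> i} \<in> events"
      unfolding full by auto
    ultimately have "prob {\<omega> \<in> space M. \<forall>i. union_process Y \<omega> i} = 1"
      by (subst prob_eq_1)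
    with less show False by simp
  qed
qed

section \<open>The law of the union process and its ergodicity\<close>

definition law :: "(int \<Rightarrow> bool) measure" where
  "law = distr M borel (union_process Y)"

lemma law_prob_space: "prob_space law"
  unfolding law_def by (rule prob_space_distr) simp

lemma sets_law: "sets law = sets borel"
  by (simp add: law_def)

lemma law_avoiding:
  assumes "emeasure \<nu> (hitting {0}) < \<infinity>" "finite F"
  shows "measure law (avoiding F) = exp (- measure \<nu> (hitting F))"
  using prob_void[OF _ emeasure_hitting_finite[OF assms]] assms(2)
  by (simp add: law_def measure_distr union_process_vimage_avoiding)

text \<open>A union bound reduces to pairs of sites, and translating by -g leaves k alone in the
  second factor, the shape treated by \<open>cesaro_hitting_null\<close>.\<close>

lemma measure_hitting_Int_le:
  assumes F: "finite F" and G: "finite G"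
  shows "measure \<nu> (hitting F \<inter> hitting ((\<lambda>i. i + k) ` G))
    \<le> (\<Sum>(f, g)\<in>F \<times> G. measure \<nu> (hitting {f - g} \<inter> hitting {k}))"
proof -
  have "hitting F \<inter> hitting ((\<lambda>i. i + k) ` G) = (\<Union>(f, g)\<in>F \<times> G. hitting {f} \<inter> hitting {g + k})"
    by (auto simp: hitting_def)
  also have "measure \<nu> \<dots> \<le> (\<Sum>(f, g)\<in>F \<times> G. measure \<nu> (hitting {f} \<inter> hitting {g + k}))"
    using measure_UNION_le[of "F \<times> G" "\<lambda>(f, g). hitting {f} \<inter> hitting {g + k}" \<nu>] F G
    by (auto simp: case_prod_beta)
  also have "\<dots> = (\<Sum>(f, g)\<in>F \<times> G. measure \<nu> (hitting {f - g} \<inter> hitting {k}))"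
  proof (intro sum.cong refl, clarify)
    fix f g
    show "measure \<nu> (hitting {f} \<inter> hitting {g + k}) = measure \<nu> (hitting {f - g} \<inter> hitting {k})"
      using emeasure_hitting_Int_shift[of g "{f - g}" "{k}"] by (simp add: measure_def add.commute)
  qed
  finally show ?thesis .
qed

text \<open>By inclusion-exclusion the joint void probability is the product of the two void
  probabilities times the exponential of the mass \<open>c k\<close> of sets meeting both regions;
  the Cesaro means of \<open>c k\<close> vanish.\<close>

lemma law_ergodic:
  assumes fin: "emeasure \<nu> (hitting {0}) < \<infinity>"
    and null: "emeasure \<nu> (space \<nu> - zero_density) = 0"
  shows "shift_ergodic law"
proof (rule shift_ergodicI[OF law_prob_space sets_law])
  note fmeas = hitting_fmeasurable[OF fin]
  have shift: "measure \<nu> (hitting ((\<lambda>i. i + n) ` F)) = measure \<nu> (hitting F)" for F n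
    using emeasure_hitting_shift[of n F] by (simp add: measure_def)
  show "measure law (avoiding ((\<lambda>i. i + 1) ` F)) = measure law (avoiding F)" if "finite F" for F
    using that by (simp add: law_avoiding[OF fin] shift)
  fix F G :: "int set" assume F: "finite F" and G: "finite G"
  define c where "c k = measure \<nu> (hitting F \<inter> hitting ((\<lambda>i. i + int k) ` G))" for k
  define e where "e k = (\<Sum>(f, g)\<in>F \<times> G. measure \<nu> (hitting {f - g} \<inter> hitting {int k}))" for k
  define x where "x k = measure law (avoiding (F \<union> (\<lambda>i. i + int k) ` G))" for k
  define b where "b = measure law (avoiding F) * measure law (avoiding G)"
  have x: "b \<le> x k \<and> x k \<le> b + e k" for k
  proof -
    have "measure \<nu> (hitting (F \<union> (\<lambda>i. i + int k) ` G)) =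
        measure \<nu> (hitting F) + measure \<nu> (hitting G) - c k"
      unfolding hitting_Un c_def using F G by (subst measure_Un3) (auto simp: fmeas shift)
    then have xk: "x k = exp (- (measure \<nu> (hitting F) + measure \<nu> (hitting G) - c k))"
      using F G by (simp add: x_def law_avoiding[OF fin])
    have bk: "b = x k * exp (- c k)"
      using F G by (simp add: b_def xk law_avoiding[OF fin] exp_add[symmetric])
    have c0: "0 \<le> c k" by (simp add: c_def)
    \<comment> \<open>Using 1 - exp(-c) \<le> c, the deviation from independence is bounded by
      \<open>c k\<close> itself.\<close>
    have "x k - b = x k * (1 - exp (- c k))"
      by (simp add: bk right_diff_distrib)
    also have "\<dots> \<le> 1 * (1 - exp (- c k))"
      using c0 law_prob_space
      by (intro mult_right_mono) (auto simp: x_def intro: prob_space.prob_le_1)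
    also have "\<dots> \<le> c k" using exp_ge_add_one_self[of "- c k"] by simp
    also have "c k \<le> e k"
      unfolding c_def e_def using F G by (rule measure_hitting_Int_le)
    finally have "x k \<le> b + e k" by simp
    moreover have "b \<le> x k"
      using c0 unfolding bk by (intro mult_left_le) (auto simp: xk)
    ultimately show ?thesis by simp
  qed
  have "(\<lambda>n. \<Sum>(f, g)\<in>F \<times> G. (\<Sum>k<n. measure \<nu> (hitting {f - g} \<inter> hitting {int k})) / real n)
      \<longlonglongrightarrow> (\<Sum>(f, g)\<in>F \<times> G. 0)"
    unfolding case_prod_beta by (intro tendsto_sum cesaro_hitting_null fin null)
  moreover have "(\<Sum>k<n. e k) / real n =
      (\<Sum>(f, g)\<in>F \<times> G. (\<Sum>k<n. measure \<nu> (hitting {f - g} \<inter> hitting {int k})) / real n)" for n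
    unfolding e_def case_prod_beta sum.swap[of _ "F \<times> G"] by (simp add: sum_divide_distrib)
  ultimately have e: "(\<lambda>n. (\<Sum>k<n. e k) / real n) \<longlonglongrightarrow> 0" by simp
  have "(\<lambda>n. (\<Sum>k<n. x k) / real n) \<longlonglongrightarrow> b"
  proof (rule tendsto_sandwich)
    show "\<forall>\<^sub>F n in sequentially. (\<Sum>k<n. b) / real n \<le> (\<Sum>k<n. x k) / real n"
      by (intro always_eventually allI divide_right_mono sum_mono) (use x in auto)
    show "\<forall>\<^sub>F n in sequentially. (\<Sum>k<n. x k) / real n \<le> (\<Sum>k<n. b) / real n + (\<Sum>k<n. e k) / real n"
      unfolding add_divide_distrib[symmetric] sum.distrib[symmetric]
      by (intro always_eventually allI divide_right_mono sum_mono) (use x in auto)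
    show "(\<lambda>n. (\<Sum>k<n. b) / real n + (\<Sum>k<n. e k) / real n) \<longlonglongrightarrow> b"
      using tendsto_add[OF cesaro_const e] by simp
  qed (rule cesaro_const)
  then show "(\<lambda>n. (\<Sum>k<n. measure law (avoiding (F \<union> (\<lambda>i. i + int k) ` G))) / real n)
      \<longlonglongrightarrow> measure law (avoiding F) * measure law (avoiding G)"
    by (simp add: x_def b_def)
qed

text \<open>Conditioning on the absence of points in a finite invariant set \<open>A\<close> yields an invariant law
  absolutely continuous with respect to that of the process, but with a smaller density of ones.\<close>

lemma law_not_ergodic:
  assumes fin: "emeasure \<nu> (hitting {0}) < \<infinity>"
    and A: "invariant_set A" "emeasure \<nu> A \<noteq> 0" "emeasure \<nu> A < \<infinity>"
  shows "\<not> shift_ergodic law"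
proof
  assume ergodic: "shift_ergodic law"
  have A_sets[measurable]: "A \<in> sets \<nu>" using A(1) by (simp add: invariant_set_def)
  \<comment> \<open>Since A has finite measure, the conditioning event has positive
    probability.\<close>
  define U where "U = uniform_measure M (void A)"
  define \<rho> where "\<rho> = distr U borel (union_process Y)"
  have prob_A: "prob (void A) = exp (- measure \<nu> A)"
    using A(3) by (simp add: prob_void)
  then have nonzero: "emeasure M (void A) \<noteq> 0" "emeasure M (void A) \<noteq> \<infinity>"
    by (simp_all add: emeasure_eq_measure)
  have U: "prob_space U" unfolding U_def using nonzero by (rule prob_space_uniform_measure)
  have X_U: "union_process Y \<in> measurable U borel"
    using union_process_measurable by (simp add: U_def cong: measurable_cong_sets)
  have \<rho>: "prob_space \<rho>" unfolding \<rho>_def using X_U by (rule prob_space.prob_space_distr[OF U])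
  have sets_\<rho>: "sets \<rho> = sets borel" by (simp add: \<rho>_def)
  note fmeas = hitting_fmeasurable[OF fin]
  have A_fmeas: "A \<in> fmeasurable \<nu>" using A(3) by (intro fmeasurableI) auto
  \<comment> \<open>These are the void probabilities of a Poisson union whose intensity is \<nu>
    restricted to the complement of A; the quotient formula comes from
    \<open>void_Un\<close>.\<close>
  have \<rho>_avoiding: "measure \<rho> (avoiding F) = exp (measure \<nu> A - measure \<nu> (A \<union> hitting F))"
    if F: "finite F" for F
  proof -
    have "A \<union> hitting F \<in> fmeasurable \<nu>" using A_fmeas fmeas[OF F] by (rule fmeasurable.Un)
    then have "emeasure \<nu> (A \<union> hitting F) < \<infinity>" by (simp add: fmeasurable_def)
    moreover have "measure \<rho> (avoiding F) = prob (void A \<inter> void (hitting F)) / prob (void A)"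
      using F nonzero X_U
      by (simp add: \<rho>_def measure_distr U_def union_process_vimage_avoiding)
    ultimately show ?thesis
      by (simp add: void_Un[symmetric] prob_void prob_A exp_diff exp_minus field_simps)
  qed
  have "distr \<rho> \<rho> shift = \<rho>"
  proof (rule distr_shift_eqI[OF \<rho> sets_\<rho>])
    fix F :: "int set" assume F: "finite F"
    have "translate 1 -` A \<inter> space \<nu> = A" using A(1) by (simp add: invariant_set_def)
    moreover have "translate 1 -` hitting ((\<lambda>i. i + 1) ` F) \<inter> space \<nu> = hitting F"
      by (simp add: translate_vimage_hitting image_image)
    ultimately have "translate 1 -` (A \<union> hitting ((\<lambda>i. i + 1) ` F)) \<inter> space \<nu> = A \<union> hitting F"
      by (simp only: vimage_Un Int_Un_distrib2)
    then have "measure \<nu> (A \<union> hitting ((\<lambda>i. i + 1) ` F)) = measure \<nu> (A \<union> hitting F)"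
      using emeasure_translate[of "A \<union> hitting ((\<lambda>i. i + 1) ` F)" 1] by (simp add: measure_def)
    then show "measure \<rho> (avoiding ((\<lambda>i. i + 1) ` F)) = measure \<rho> (avoiding F)"
      using F by (simp add: \<rho>_avoiding)
  qed
  moreover have "absolutely_continuous law \<rho>"
    unfolding absolutely_continuous_def
  proof
    fix B assume "B \<in> null_sets law"
    then have B: "B \<in> sets borel" "emeasure M (union_process Y -` B \<inter> space M) = 0"
      by (auto simp: law_def null_sets_def emeasure_distr)
    have ev: "union_process Y -` B \<inter> space M \<in> events"
      using B(1) by (rule measurable_sets[OF union_process_measurable])
    have "emeasure M (void A \<inter> (union_process Y -` B \<inter> space M)) = 0"
      using emeasure_mono[of "void A \<inter> (union_process Y -` B \<inter> space M)" _ M, OF _ ev] B(2)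
      by auto
    then have "emeasure \<rho> B = 0"
      using B(1) ev X_U by (simp add: \<rho>_def emeasure_distr U_def)
    then show "B \<in> null_sets \<rho>" using B(1) by (simp add: null_sets_def sets_\<rho>)
  qed
  ultimately have "\<rho> = law"
    using shift_ergodic_absolutely_continuous_unique[OF law_prob_space sets_law ergodic \<rho> sets_\<rho>]
    by blast
  \<comment> \<open>Comparing void probabilities at the single site 0 shows that no mass of A
    contains 0, which contradicts \<open>invariant_set_null\<close>.\<close>
  then have "exp (measure \<nu> A - measure \<nu> (A \<union> hitting {0})) = exp (- measure \<nu> (hitting {0}))"
    using \<rho>_avoiding[of "{0}"] law_avoiding[OF fin, of "{0}"] by simp
  then have "measure \<nu> (A \<union> hitting {0}) = measure \<nu> A + measure \<nu> (hitting {0})"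
    by simp
  moreover have "measure \<nu> (A \<union> hitting {0}) =
      measure \<nu> A + measure \<nu> (hitting {0}) - measure \<nu> (A \<inter> hitting {0})"
    using A_fmeas fmeas by (intro measure_Un3) auto
  ultimately have "measure \<nu> (A \<inter> hitting {0}) = 0" by simp
  moreover have "A \<inter> hitting {0} \<in> fmeasurable \<nu>"
    using A_fmeas by (intro fmeasurable_Int_fmeasurable) auto
  ultimately have "emeasure \<nu> (A \<inter> hitting {0}) = 0"
    by (simp add: emeasure_eq_measure2)
  with A show False using invariant_set_null by blast
qed

end

theorem theorem7p3:
  fixes \<nu> :: "int set measure" and M :: "'w measure" and Y :: "'w \<Rightarrow> nat \<rightharpoonup> int set"
  assumes "sets \<nu> = sets nonempty_subsets_borel"
    and "sigma_finite_measure \<nu>"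
    and "translation_invariant \<nu>"
    and "poisson_process M \<nu> Y"
  shows "(measure M {\<omega> \<in> space M. \<forall>i. union_process Y \<omega> i} < 1 \<longleftrightarrow>
            emeasure \<nu> containing_zero < \<infinity>) \<and>
         (measure M {\<omega> \<in> space M. \<forall>i. union_process Y \<omega> i} < 1 \<longrightarrow>
           (\<not> has_finite_invariant_part \<nu> \<longleftrightarrow> emeasure \<nu> (space \<nu> - zero_density) = 0) \<and>
           (emeasure \<nu> (space \<nu> - zero_density) = 0 \<longleftrightarrow> ergodic_process M (union_process Y)))"
proof -
  interpret poisson_process M \<nu> Y by fact
  interpret invariant_poisson \<nu> M Y
    using assms(1,3) by unfold_locales
  have "invariant_intensity \<nu>" by unfold_locales
  note finite_part = has_finite_invariant_partI not_has_finite_invariant_partI[OF this]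
  \<comment> \<open>If (ii) fails, one finite invariant set of positive measure refutes both (i) and
    (iii).\<close>
  show ?thesis
    unfolding containing_zero_eq prob_full_less_1_iff ergodic_process_def law_def[symmetric]
    using finite_part ex_finite_invariant_set law_ergodic law_not_ergodic by blast
qed

end
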